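(* Let $f\in L^2(0,T;V^\star)$ and $y_0\in H$. For $v,w\in W(0,T)$ define $$b(v,w):=\int_0^T (v_t,w_t)_{V^\star}\,dt+\int_0^T(v,w)_V\,dt+(v(T),w(T))_H,$$ $$l(w):=(y_0,w(0))_H+\int_0^T(f,w_t)_{V^\star}\,dt+\int_0^T\langle f,w\rangle_{V^\star,V}\,dt.$$ Then the bilinear form $b:W(0,T)\times W(0,T)\to\mathbb{R}$ is symmetric, bounded and coercive (with respect to the norm of $W(0,T)$), and the linear form $l:W(0,T)\to\mathbb{R}$ is continuous.
   Context: $V$ and $H$ are real separable Hilbert spaces with $V\hookrightarrow H\equiv H^\star\hookrightarrow V^\star$ forming a Gelfand triple (continuous dense embeddings). $a:V\times V\to\mathbb{R}$ is a symmetric, continuous, coercive bilinear form, and $V$ is equipped with the inner product $(u,v)_V:=a(u,v)$. $A:V\to V^\star$ is the Riesz isomorphism $\langle Au,v\rangle_{V^\star,V}:=a(u,v)$, and $R:=A^{-1}:V^\star\to V$ is the Riesz lift. $V^\star$ carries the inner product $(\phi,\psi)_{V^\star}:=(R\phi,R\psi)_V$. For $T>0$, $W(0,T):=\{v\in L^2(0,T;V)\mid v_t\in L^2(0,T;V^\star)\}$ with inner product $(u,v)_{W(0,T)}:=\int_0^T(u_t,v_t)_{V^\star}+\int_0^T(u,v)_V$ and induced norm $\|\cdot\|_{W(0,T)}$. Point values $v(0),v(T)\in H$ are understood via the continuous embedding $W(0,T)\hookrightarrow C([0,T],H)$. *)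

theory Defs
  imports "HOL-Analysis.Analysis"
begin

definition dense_embedding :: "('a::real_normed_vector \<Rightarrow> 'b::real_normed_vector) \<Rightarrow> bool" where
  "dense_embedding j \<longleftrightarrow> bounded_linear j \<and> inj j \<and> closure (range j) = UNIV"

text \<open>The embedding of \<open>H\<close> (identified with its dual) into the dual of \<open>V\<close>
  that is induced by an embedding \<open>\<iota>\<close> of \<open>V\<close> into \<open>H\<close>.\<close>

definition pivot_embedding ::
    "('v::real_normed_vector \<Rightarrow> 'h::real_inner) \<Rightarrow> 'h \<Rightarrow> ('v \<Rightarrow>\<^sub>L real)" where
  "pivot_embedding \<iota> h = Blinfun (\<lambda>w. h \<bullet> \<iota> w)"

definition gelfand_triple :: "('v::real_inner \<Rightarrow> 'h::real_inner) \<Rightarrow> bool" where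
  "gelfand_triple \<iota> \<longleftrightarrow> dense_embedding \<iota> \<and> dense_embedding (pivot_embedding \<iota>)"

definition symmetric_on :: "'a set \<Rightarrow> ('a \<Rightarrow> 'a \<Rightarrow> real) \<Rightarrow> bool" where
  "symmetric_on S b \<longleftrightarrow> (\<forall>u\<in>S. \<forall>v\<in>S. b u v = b v u)"

definition bounded_form_on :: "'a set \<Rightarrow> ('a \<Rightarrow> real) \<Rightarrow> ('a \<Rightarrow> 'a \<Rightarrow> real) \<Rightarrow> bool" where
  "bounded_form_on S nrm b \<longleftrightarrow> (\<exists>C. \<forall>u\<in>S. \<forall>v\<in>S. \<bar>b u v\<bar> \<le> C * nrm u * nrm v)"

definition coercive_on :: "'a set \<Rightarrow> ('a \<Rightarrow> real) \<Rightarrow> ('a \<Rightarrow> 'a \<Rightarrow> real) \<Rightarrow> bool" where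
  "coercive_on S nrm b \<longleftrightarrow> (\<exists>\<alpha>>0. \<forall>v\<in>S. \<alpha> * (nrm v)\<^sup>2 \<le> b v v)"

definition riesz_iso :: "('v::real_normed_vector \<Rightarrow> 'v \<Rightarrow> real) \<Rightarrow> 'v \<Rightarrow> ('v \<Rightarrow>\<^sub>L real)" where
  "riesz_iso a u = Blinfun (a u)"

definition riesz_lift :: "('v::real_normed_vector \<Rightarrow> 'v \<Rightarrow> real) \<Rightarrow> ('v \<Rightarrow>\<^sub>L real) \<Rightarrow> 'v" where
  "riesz_lift a = inv (riesz_iso a)"

definition dual_inner ::
    "('v::real_normed_vector \<Rightarrow> 'v \<Rightarrow> real) \<Rightarrow> ('v \<Rightarrow>\<^sub>L real) \<Rightarrow> ('v \<Rightarrow>\<^sub>L real) \<Rightarrow> real" where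
  "dual_inner a \<phi> \<psi> = a (riesz_lift a \<phi>) (riesz_lift a \<psi>)"

text \<open>Elements of \<open>L\<^sup>2(0,T;X)\<close> are represented by functions on the real line, of which only the
  values on \<open>(0,T)\<close> matter; equality in \<open>L\<^sup>2(0,T;X)\<close> is \<open>ae_eq\<close>.
  Borel measurability coincides with strong measurability when \<open>X\<close> is separable, as \<open>V\<close> and its
  dual are.  Membership is expressed with the ambient norms of \<open>V\<close> and of its dual; these
  are equivalent to the norms induced by the form \<open>a\<close>, so that the spaces are the same.\<close>

abbreviation time_measure :: "real \<Rightarrow> real measure" where
  "time_measure T \<equiv> lebesgue_on {0<..<T}"

definition L2_space :: "real \<Rightarrow> (real \<Rightarrow> 'x::real_normed_vector) set" where
  "L2_space T = {v. v \<in> borel_measurable (time_measure T) \<and>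
                    integrable (time_measure T) (\<lambda>t. (norm (v t))\<^sup>2)}"

definition ae_eq :: "real \<Rightarrow> (real \<Rightarrow> 'x) \<Rightarrow> (real \<Rightarrow> 'x) \<Rightarrow> bool" where
  "ae_eq T u v \<longleftrightarrow> (AE t in time_measure T. u t = v t)"

definition test_function :: "real \<Rightarrow> (real \<Rightarrow> real) \<Rightarrow> bool" where
  "test_function T \<phi> \<longleftrightarrow> (\<forall>n x. (deriv ^^ n) \<phi> differentiable at x) \<and>
                         closure {x. \<phi> x \<noteq> 0} \<subseteq> {0<..<T}"

text \<open>The identity \<open>\<integral> \<phi>' v dt = - \<integral> \<phi> g dt\<close> in the dual of \<open>V\<close>, evaluated at each \<open>w\<close> in \<open>V\<close>.
  (The Bochner integral of the library is not available for functions with values in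
  \<open>'v \<Rightarrow>\<^sub>L real\<close>, since this type is not an instance of \<open>second_countable_topology\<close>.)\<close>

definition has_weak_deriv ::
    "real \<Rightarrow> ('v::real_normed_vector \<Rightarrow> 'h::real_inner) \<Rightarrow> (real \<Rightarrow> 'v) \<Rightarrow> (real \<Rightarrow> ('v \<Rightarrow>\<^sub>L real)) \<Rightarrow> bool"
  where
  "has_weak_deriv T \<iota> v g \<longleftrightarrow>
     (\<forall>\<phi> w. test_function T \<phi> \<longrightarrow>
        (LINT t|time_measure T. deriv \<phi> t * blinfun_apply (pivot_embedding \<iota> (\<iota> (v t))) w) =
        - (LINT t|time_measure T. \<phi> t * blinfun_apply (g t) w))"

definition W_space ::
    "real \<Rightarrow> ('v::real_normed_vector \<Rightarrow> 'h::real_inner) \<Rightarrow> (real \<Rightarrow> 'v) set" where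
  "W_space T \<iota> = {v \<in> L2_space T. \<exists>g \<in> L2_space T. has_weak_deriv T \<iota> v g}"

text \<open>For \<open>v\<close> in \<open>W_space T \<iota>\<close> the weak derivative is unique up to equality almost everywhere.\<close>

definition weak_deriv ::
    "real \<Rightarrow> ('v::real_normed_vector \<Rightarrow> 'h::real_inner) \<Rightarrow> (real \<Rightarrow> 'v) \<Rightarrow> real \<Rightarrow> ('v \<Rightarrow>\<^sub>L real)" where
  "weak_deriv T \<iota> v = (SOME g. g \<in> L2_space T \<and> has_weak_deriv T \<iota> v g)"

text \<open>The value at \<open>t\<close> in \<open>[0,T]\<close> of the representative of \<open>v\<close> in \<open>C([0,T],H)\<close>.\<close>

definition point_value ::
    "real \<Rightarrow> ('v::real_normed_vector \<Rightarrow> 'h::real_inner) \<Rightarrow> (real \<Rightarrow> 'v) \<Rightarrow> real \<Rightarrow> 'h" where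
  "point_value T \<iota> v t =
     (THE h. \<exists>g. continuous_on {0..T} g \<and> ae_eq T g (\<lambda>s. \<iota> (v s)) \<and> g t = h)"

definition W_inner ::
    "real \<Rightarrow> ('v::real_normed_vector \<Rightarrow> 'v \<Rightarrow> real) \<Rightarrow> ('v \<Rightarrow> 'h::real_inner) \<Rightarrow>
     (real \<Rightarrow> 'v) \<Rightarrow> (real \<Rightarrow> 'v) \<Rightarrow> real" where
  "W_inner T a \<iota> u v =
     (LINT t|time_measure T. dual_inner a (weak_deriv T \<iota> u t) (weak_deriv T \<iota> v t)) +
     (LINT t|time_measure T. a (u t) (v t))"

definition W_norm ::
    "real \<Rightarrow> ('v::real_normed_vector \<Rightarrow> 'v \<Rightarrow> real) \<Rightarrow> ('v \<Rightarrow> 'h::real_inner) \<Rightarrow> (real \<Rightarrow> 'v) \<Rightarrow> real" where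
  "W_norm T a \<iota> v = sqrt (W_inner T a \<iota> v v)"

definition b_form ::
    "real \<Rightarrow> ('v::real_normed_vector \<Rightarrow> 'v \<Rightarrow> real) \<Rightarrow> ('v \<Rightarrow> 'h::real_inner) \<Rightarrow>
     (real \<Rightarrow> 'v) \<Rightarrow> (real \<Rightarrow> 'v) \<Rightarrow> real" where
  "b_form T a \<iota> v w =
     (LINT t|time_measure T. dual_inner a (weak_deriv T \<iota> v t) (weak_deriv T \<iota> w t)) +
     (LINT t|time_measure T. a (v t) (w t)) +
     point_value T \<iota> v T \<bullet> point_value T \<iota> w T"

definition l_form ::
    "real \<Rightarrow> ('v::real_normed_vector \<Rightarrow> 'v \<Rightarrow> real) \<Rightarrow> ('v \<Rightarrow> 'h::real_inner) \<Rightarrow>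
     (real \<Rightarrow> ('v \<Rightarrow>\<^sub>L real)) \<Rightarrow> 'h \<Rightarrow> (real \<Rightarrow> 'v) \<Rightarrow> real" where
  "l_form T a \<iota> f y0 w =
     y0 \<bullet> point_value T \<iota> w 0 +
     (LINT t|time_measure T. dual_inner a (f t) (weak_deriv T \<iota> w t)) +
     (LINT t|time_measure T. blinfun_apply (f t) (w t))"

text \<open>Forms on a space whose elements are functions modulo equality almost everywhere; they have
  to be compatible with that equality.\<close>

definition linear_form_on :: "real \<Rightarrow> (real \<Rightarrow> 'v::real_vector) set \<Rightarrow> ((real \<Rightarrow> 'v) \<Rightarrow> real) \<Rightarrow> bool" where
  "linear_form_on T W l \<longleftrightarrow>
     (\<forall>u\<in>W. \<forall>v\<in>W. ae_eq T u v \<longrightarrow> l u = l v) \<and>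
     (\<forall>u\<in>W. \<forall>v\<in>W. l (\<lambda>t. u t + v t) = l u + l v) \<and>
     (\<forall>c. \<forall>u\<in>W. l (\<lambda>t. c *\<^sub>R u t) = c * l u)"

definition bilinear_form_on ::
    "real \<Rightarrow> (real \<Rightarrow> 'v::real_vector) set \<Rightarrow> ((real \<Rightarrow> 'v) \<Rightarrow> (real \<Rightarrow> 'v) \<Rightarrow> real) \<Rightarrow> bool" where
  "bilinear_form_on T W b \<longleftrightarrow>
     (\<forall>w\<in>W. linear_form_on T W (\<lambda>v. b v w)) \<and> (\<forall>v\<in>W. linear_form_on T W (b v))"

definition continuous_form_on ::
    "(real \<Rightarrow> 'v::real_vector) set \<Rightarrow> ((real \<Rightarrow> 'v) \<Rightarrow> real) \<Rightarrow> ((real \<Rightarrow> 'v) \<Rightarrow> real) \<Rightarrow> bool" where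
  "continuous_form_on W nrm l \<longleftrightarrow>
     (\<forall>u\<in>W. \<forall>\<epsilon>>0. \<exists>\<delta>>0. \<forall>v\<in>W. nrm (\<lambda>t. v t - u t) < \<delta> \<longrightarrow> \<bar>l v - l u\<bar> < \<epsilon>)"

end

theory Submission
  imports Defs
begin

text \<open>Since \<open>b v v\<close> equals the square of the norm of \<open>v\<close> plus \<open>\<bar>v(T)\<bar>\<^sup>2\<close>, everything reduces to
  the trace estimate \<open>\<bar>v(t)\<bar>\<^sup>2 \<le> C (v,v)\<^bsub>W\<^esub>\<close>, that is, to the embedding of \<open>W(0,T)\<close> into
  \<open>C([0,T],H)\<close>.  Let \<open>S\<close> be the composition of \<open>V \<rightarrow> H \<rightarrow> V\<^sup>*\<close> with the Riesz lift, so that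
  \<open>a(Sx,y) = (x,y)\<^bsub>H\<^esub>\<close>, and let \<open>G\<close> be the Riesz lift of \<open>v\<^sub>t\<close>.  Then \<open>Sv\<close> agrees almost everywhere
  with a function \<open>U = c + \<integral> G\<close> that is absolutely continuous with values in \<open>V\<close>.  Instead of
  mollifying in time, regularise in space by \<open>v\<^sub>\<epsilon> = (\<epsilon> + S)\<^sup>-\<^sup>1 U\<close>.  As \<open>(\<epsilon> + S)\<^sup>-\<^sup>1 S\<close> is a contraction
  for \<open>a\<close> that converges strongly to the identity, integration by parts for \<open>\<bar>v\<^sub>\<epsilon>\<bar>\<^sup>2\<close> and
  \<open>\<bar>v\<^sub>\<epsilon> - v\<^sub>\<delta>\<bar>\<^sup>2\<close> shows that the continuous functions \<open>v\<^sub>\<epsilon>\<close> are bounded in \<open>H\<close> by the norm of \<open>v\<close>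
  and uniformly Cauchy; their limit is the continuous representative of \<open>v\<close>.\<close>

subsection \<open>Coercive symmetric forms and the Riesz lift\<close>

text \<open>In general \<open>S\<close> has no bounded inverse, so the continuity of
  \<open>U\<close> in V says nothing directly about v. Each resolvent is bounded, but its norm may
  grow as \<open>\<epsilon>\<close> tends to 0; only its product with \<open>S\<close> is bounded
  uniformly. The estimates are arranged so that nothing else occurs. Almost everywhere the resolvent
  meets \<open>U = S v\<close>, and half the derivative of the squared H-norm of the regularised
  function is \<open>a (S (L G)) (L U)\<close> with \<open>L\<close> the resolvent: the factor
  \<open>S\<close>, which turns the product of H into the form, falls on the side of
  \<open>G\<close>. This is why a derivative with values in the dual of V suffices. The
  regularisation acts at each time separately, so v need not be extended beyond (0,T) and the
  endpoints need no special care. No value of v is controlled in advance; the value at t is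
  therefore compared with the mean over (0,T), which brings a factor 1/T into the trace constant.
  Vector-valued integrals are taken in V, after the Riesz lift. The test functions that lead from
  the weak derivative to \<open>U\<close> are explicit, built from exp(-1/y).\<close>

lemma quadratic_nonneg_imp_discriminant:
  fixes p q r :: real
  assumes "\<And>s. 0 \<le> p + 2 * s * q + s\<^sup>2 * r"
  shows "q\<^sup>2 \<le> p * r"
proof (cases "r = 0")
  case True
  have "q = 0"
  proof (rule ccontr)
    assume "q \<noteq> 0"
    then have "p + 2 * (- (p + 1) / (2 * q)) * q = - 1" by (simp add: field_simps)
    with assms[of "- (p + 1) / (2 * q)"] True show False by simp
  qed
  with True show ?thesis by simp
next
  case False
  have "r \<ge> 0"
  proof (rule ccontr)
    assume "\<not> r \<ge> 0"
    then obtain t where t: "r = - t" "t > 0" by (metis neg_0_less_iff_less not_le minus_minus)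
    \<comment> \<open>Chosen so that \<open>s * t\<close> exceeds
      \<open>\<bar>p\<bar> + 2 * \<bar>q\<bar>\<close> by exactly \<open>t\<close>;
      \<open>s \<ge> 1\<close> allows \<open>p\<close> to be absorbed into
      \<open>\<bar>p\<bar> * s\<close>.\<close>
    define s where "s = 1 + \<bar>p\<bar> / t + 2 * \<bar>q\<bar> / t"
    have s: "s \<ge> 1" using t by (simp add: s_def)
    have "p + 2 * s * q + s\<^sup>2 * r \<le> \<bar>p\<bar> * s + 2 * s * \<bar>q\<bar> + s\<^sup>2 * r"
      using s mult_left_mono[of q "\<bar>q\<bar>" "2 * s"] mult_left_mono[of 1 s "\<bar>p\<bar>"] by (simp, linarith)
    also have "\<dots> = s * (\<bar>p\<bar> + 2 * \<bar>q\<bar> - s * t)"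
      by (simp add: t power2_eq_square algebra_simps)
    also have "s * t = t + \<bar>p\<bar> + 2 * \<bar>q\<bar>"
      using t by (simp add: s_def field_simps)
    also have "s * (\<bar>p\<bar> + 2 * \<bar>q\<bar> - (t + \<bar>p\<bar> + 2 * \<bar>q\<bar>)) = s * r" by (simp add: t)
    also have "\<dots> < 0" using s \<open>\<not> r \<ge> 0\<close> by (simp add: mult_less_0_iff)
    finally show False using assms[of s] by simp
  qed
  with False have "r > 0" by simp
  with assms[of "- q / r"] show ?thesis
    by (simp add: field_simps power2_eq_square)
qed

text \<open>The Riesz theory is used for two forms, \<open>a\<close> itself and the perturbed form
  \<open>form_eps\<close> that defines the resolvent.\<close>

locale coercive_form =
  fixes a :: "'v::banach \<Rightarrow> 'v \<Rightarrow> real"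
  assumes bilinear: "bounded_bilinear a"
    and sym: "a x y = a y x"
    and coercive: "coercive_on UNIV norm a"
begin

sublocale form: bounded_bilinear a by (rule bilinear)

definition \<alpha> :: real where
  "\<alpha> = (SOME c. c > 0 \<and> (\<forall>v. c * (norm v)\<^sup>2 \<le> a v v))"

lemma \<alpha>_pos: "\<alpha> > 0" and \<alpha>_le: "\<alpha> * (norm x)\<^sup>2 \<le> a x x"
proof -
  have "\<exists>c. c > 0 \<and> (\<forall>v. c * (norm v)\<^sup>2 \<le> a v v)"
    using coercive by (auto simp: coercive_on_def)
  from someI_ex[OF this] show "\<alpha> > 0" "\<alpha> * (norm x)\<^sup>2 \<le> a x x"
    by (auto simp: \<alpha>_def)
qed

lemma form_nonneg: "0 \<le> a x x"
  using \<alpha>_le[of x] \<alpha>_pos by (meson mult_nonneg_nonneg less_imp_le order_trans zero_le_power2)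

lemma norm_sq_le_form: "(norm x)\<^sup>2 \<le> a x x / \<alpha>"
  using \<alpha>_le[of x] \<alpha>_pos by (simp add: field_simps)

lemma form_eq_0_imp: "a x x = 0 \<Longrightarrow> x = 0"
  using norm_sq_le_form[of x] by simp

lemma form_diff_self: "a (x - y) (x - y) = a x x - 2 * a x y + a y y"
  by (simp add: form.diff_left form.diff_right sym[of y x])

lemma form_add_self: "a (x + y) (x + y) = a x x + 2 * a x y + a y y"
  by (simp add: form.add_left form.add_right sym[of y x])

lemma form_eqI: "(\<And>w. a x w = a y w) \<Longrightarrow> x = y"
  using form_eq_0_imp[of "x - y"] by (simp add: form.diff_left)

text \<open>Direct method: the quadratic functional \<open>J\<close> has a minimiser by coercivity
  and completeness, and the vanishing of its first variation there is the claim.\<close>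

lemma riesz_representation:
  assumes "bounded_linear \<phi>"
  shows "\<exists>u. \<forall>w. a u w = \<phi> w"
proof -
  interpret \<phi>: bounded_linear \<phi> by fact
  obtain K where K: "\<And>x. \<bar>\<phi> x\<bar> \<le> norm x * K" using \<phi>.bounded by auto
  define J where "J x = a x x - 2 * \<phi> x" for x
  have low: "- (K\<^sup>2 / \<alpha>) \<le> J x" for x
  proof -
    \<comment> \<open>Completing the square in \<open>norm x\<close> gives a lower bound for
      \<open>J\<close> that does not depend on \<open>x\<close>.\<close>
    have "0 \<le> (\<alpha> * norm x - K)\<^sup>2 / \<alpha>" using \<alpha>_pos by simp
    also have "\<dots> = \<alpha> * (norm x)\<^sup>2 - 2 * (norm x * K) + K\<^sup>2 / \<alpha>"
      using \<alpha>_pos by (simp add: field_simps power2_eq_square)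
    finally show ?thesis using \<alpha>_le[of x] K[of x] by (simp add: J_def)
  qed
  define m where "m = Inf (range J)"
  have bdd: "bdd_below (range J)" using low by (intro bdd_belowI[of _ "- (K\<^sup>2 / \<alpha>)"]) auto
  have m_le: "m \<le> J x" for x unfolding m_def by (rule cInf_lower[OF _ bdd]) simp
  have "\<exists>x. J x < m + 1 / real (Suc n)" for n
  proof -
    have "Inf (range J) < m + 1 / real (Suc n)" by (simp add: m_def)
    then show ?thesis using cInf_lessD[of "range J"] by blast
  qed
  then obtain X where X: "\<And>n. J (X n) < m + 1 / real (Suc n)" by metis
  \<comment> \<open>Parallelogram identity: the linear terms of \<open>J\<close> cancel, and
    \<open>J\<close> at the midpoint is at least \<open>m\<close>, so two near-minimisers are close
    to each other.\<close>
  have par: "a (x - y) (x - y) \<le> 2 * (J x - m) + 2 * (J y - m)" for x y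
  proof -
    have "a (x - y) (x - y) = 2 * J x + 2 * J y - 4 * J ((1/2) *\<^sub>R (x + y))"
      by (simp add: J_def form_diff_self form_add_self form.scaleR_left form.scaleR_right
          \<phi>.scaleR \<phi>.add algebra_simps)
    with m_le[of "(1/2) *\<^sub>R (x + y)"] show ?thesis by simp
  qed
  have "Cauchy X"
  proof (rule CauchyI)
    fix e :: real assume "e > 0"
    obtain N where N: "1 / real (Suc N) < \<alpha> * e\<^sup>2 / 4"
      using reals_Archimedean[of "\<alpha> * e\<^sup>2 / 4"] \<open>e > 0\<close> \<alpha>_pos by (auto simp: inverse_eq_divide)
    show "\<exists>M. \<forall>k\<ge>M. \<forall>l\<ge>M. norm (X k - X l) < e"
    proof (intro exI[of _ N] allI impI)
      fix k l assume "N \<le> k" "N \<le> l"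
      have X': "J (X i) - m < \<alpha> * e\<^sup>2 / 4" if "N \<le> i" for i
      proof -
        have "1 / real (Suc i) \<le> 1 / real (Suc N)" using that by (simp add: frac_le)
        then have "1 / real (Suc i) < \<alpha> * e\<^sup>2 / 4" using N by (rule le_less_trans)
        then have "m + 1 / real (Suc i) < m + \<alpha> * e\<^sup>2 / 4" by (rule add_strict_left_mono)
        with X[of i] have "J (X i) < m + \<alpha> * e\<^sup>2 / 4" by (rule less_trans)
        then show ?thesis by (simp only: diff_less_eq add.commute)
      qed
      define c where "c = \<alpha> * e\<^sup>2"
      have arith: "q < r" if "p \<le> 2 * u + 2 * v" "u < r / 4" "v < r / 4" "q \<le> p" for p q u v r :: real
        using that by linarith
      have "\<alpha> * (norm (X k - X l))\<^sup>2 < c"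
        by (rule arith[OF par[of "X k" "X l"] X'[OF \<open>N \<le> k\<close>] X'[OF \<open>N \<le> l\<close>] \<alpha>_le[of "X k - X l"], folded c_def])
      then have "(norm (X k - X l))\<^sup>2 < e\<^sup>2" using \<alpha>_pos by (simp add: c_def)
      then show "norm (X k - X l) < e" by (rule power2_less_imp_less) (use \<open>e > 0\<close> in simp)
    qed
  qed
  then obtain u where u: "X \<longlonglongrightarrow> u" using convergent_eq_Cauchy by blast
  have "(\<lambda>n. J (X n)) \<longlonglongrightarrow> J u"
    unfolding J_def by (intro tendsto_intros form.tendsto \<phi>.tendsto u)
  moreover have "(\<lambda>n. m + 1 / real (Suc n)) \<longlonglongrightarrow> m + 0"
    by (intro tendsto_intros LIMSEQ_Suc[OF lim_1_over_n])
  ultimately have Ju: "J u \<le> m"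
    using X by (auto intro: LIMSEQ_le less_imp_le)
  have "a u w = \<phi> w" for w
  proof -
    \<comment> \<open>This is \<open>J (u + s *\<^sub>R w) - J u\<close> as a polynomial in
      \<open>s\<close>. Its constant term is 0, so the discriminant bound forces the linear
      coefficient to vanish.\<close>
    have "0 \<le> 0 + 2 * s * (a u w - \<phi> w) + s\<^sup>2 * a w w" for s
    proof -
      have "J u \<le> J (u + s *\<^sub>R w)" using Ju m_le order_trans by blast
      then show ?thesis
        by (simp add: J_def form_add_self form.scaleR_left form.scaleR_right
          \<phi>.scaleR \<phi>.add algebra_simps power2_eq_square)
    qed
    from quadratic_nonneg_imp_discriminant[OF this] show ?thesis by simp
  qed
  then show ?thesis by blast
qed

lemma riesz_iso_apply [simp]: "blinfun_apply (riesz_iso a u) w = a u w"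
  unfolding riesz_iso_def using bounded_linear_Blinfun_apply[OF form.bounded_linear_right] by metis

lemma bounded_linear_riesz_iso: "bounded_linear (riesz_iso a)"
proof -
  obtain K where K: "\<And>x y. \<bar>a x y\<bar> \<le> norm x * norm y * K" "K > 0"
    using form.pos_bounded by auto
  show ?thesis
  proof (rule bounded_linear_intro[of _ K])
    show "norm (riesz_iso a x) \<le> norm x * K" for x
    proof (rule norm_blinfun_bound)
      show "norm (blinfun_apply (riesz_iso a x) w) \<le> norm x * K * norm w" for w
        using K(1)[of x w] by (simp add: ac_simps)
    qed (use K in simp)
  qed (auto intro!: blinfun_eqI simp: form.add_left form.scaleR_left blinfun.add_left blinfun.scaleR_left)
qed

lemma bij_riesz_iso: "bij (riesz_iso a)"
proof (rule bijI)
  show "inj (riesz_iso a)" by (rule injI, rule form_eqI) (metis riesz_iso_apply)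
  have "\<exists>u. riesz_iso a u = \<phi>" for \<phi>
    using riesz_representation[OF blinfun.bounded_linear_right[of \<phi>]]
    by (metis blinfun_eqI riesz_iso_apply)
  then show "surj (riesz_iso a)" by (metis surjI)
qed

lemma riesz_lift_iso [simp]: "riesz_lift a (riesz_iso a u) = u"
  unfolding riesz_lift_def using bij_riesz_iso by (simp add: bij_is_inj inv_f_f)

lemma riesz_iso_lift [simp]: "riesz_iso a (riesz_lift a \<phi>) = \<phi>"
  unfolding riesz_lift_def using bij_riesz_iso by (simp add: bij_is_surj surj_f_inv_f)

lemma form_riesz_lift [simp]: "a (riesz_lift a \<phi>) w = blinfun_apply \<phi> w"
  by (metis riesz_iso_apply riesz_iso_lift)

text \<open>The constant is that of Lax and Milgram: test the defining identity with the lift itself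
  and cancel one factor of its norm.\<close>

lemma bounded_linear_riesz_lift: "bounded_linear (riesz_lift a)"
proof (rule bounded_linear_intro[of _ "1 / \<alpha>"])
  show "riesz_lift a (x + y) = riesz_lift a x + riesz_lift a y" for x y
    by (rule form_eqI) (simp add: form.add_left blinfun.add_left)
  show "riesz_lift a (r *\<^sub>R x) = r *\<^sub>R riesz_lift a x" for r x
    by (rule form_eqI) (simp add: form.scaleR_left blinfun.scaleR_left)
  show "norm (riesz_lift a \<phi>) \<le> norm \<phi> * (1 / \<alpha>)" for \<phi>
  proof (cases "riesz_lift a \<phi> = 0")
    case False
    have "\<alpha> * (norm (riesz_lift a \<phi>))\<^sup>2 \<le> norm \<phi> * norm (riesz_lift a \<phi>)"
      using \<alpha>_le[of "riesz_lift a \<phi>"] norm_blinfun[of \<phi> "riesz_lift a \<phi>"] by simp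
    with False \<alpha>_pos show ?thesis by (simp add: field_simps power2_eq_square)
  qed (use \<alpha>_pos in simp)
qed

text \<open>The expansion leaves two non-negative extra terms. Applied to the two parts into which
  the resolvent splits a vector, this bounds the energy of each part.\<close>

lemma form_le_form_add: "a x y \<ge> 0 \<Longrightarrow> a x x \<le> a (x + y) (x + y)"
  using form_nonneg[of y] by (simp add: form_add_self)

end

subsection \<open>Smooth test functions\<close>

text \<open>The classical flat function exp(-1/y) times negative powers of y. The powers make the
  family closed under differentiation up to linear combinations.\<close>

definition flat_exp :: "nat \<Rightarrow> real \<Rightarrow> real" where
  "flat_exp k y = (if y > 0 then inverse y ^ k / exp (inverse y) else 0)"

lemma flat_exp_tendsto_0: "(flat_exp k \<longlongrightarrow> 0) (at_right 0)"
proof -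
  have "((\<lambda>y. inverse y ^ k / exp (inverse y)) \<longlongrightarrow> (0::real)) (at_right 0)"
    by (rule filterlim_compose[OF tendsto_power_div_exp_0 filterlim_inverse_at_top_right])
  then show ?thesis
    by (rule Lim_transform_eventually)
      (auto simp: eventually_at_right_field flat_exp_def intro!: exI[of _ 1])
qed

lemma flat_exp_has_derivative:
  "(flat_exp k has_real_derivative flat_exp (k + 2) y - real k * flat_exp (k + 1) y) (at y)"
proof -
  consider "y > 0" | "y < 0" | "y = 0" by linarith
  then show ?thesis
  proof cases
    case 1
    have "((\<lambda>y. inverse y ^ k) has_real_derivative - real k * inverse y ^ (k + 1)) (at y)"
      using DERIV_power[OF DERIV_inverse, of y k] 1 by (cases k) (auto simp: algebra_simps elim!: DERIV_cong)
    moreover have "((\<lambda>y. exp (- inverse y)) has_real_derivative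
        exp (- inverse y) * inverse y ^ 2) (at y)"
      using 1 by (auto intro!: derivative_eq_intros simp: power2_eq_square)
    ultimately have "((\<lambda>y. inverse y ^ k * exp (- inverse y)) has_real_derivative
        flat_exp (k + 2) y - real k * flat_exp (k + 1) y) (at y)"
      by (rule DERIV_cong[OF DERIV_mult]) (use 1 in \<open>simp add: flat_exp_def exp_minus field_simps power2_eq_square\<close>)
    then have "((\<lambda>y. inverse y ^ k / exp (inverse y)) has_real_derivative
        flat_exp (k + 2) y - real k * flat_exp (k + 1) y) (at y)"
      by (simp add: exp_minus divide_inverse)
    then show ?thesis
      by (rule has_field_derivative_transform_within_open[where S = "{0<..}"])
        (use 1 in \<open>auto simp: flat_exp_def\<close>)
  next
    case 2
    have "((\<lambda>y. 0) has_real_derivative flat_exp (k + 2) y - real k * flat_exp (k + 1) y) (at y)"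
      using 2 by (simp add: flat_exp_def)
    then show ?thesis
      by (rule has_field_derivative_transform_within_open[where S = "{..<0}"])
        (use 2 in \<open>auto simp: flat_exp_def\<close>)
  next
    case 3
    \<comment> \<open>To the right of the origin the difference quotient is
      \<open>flat_exp (Suc k)\<close>, a member of the same family, whose limit is known.\<close>
    have "((\<lambda>h. flat_exp k h / h) \<longlongrightarrow> 0) (at_right 0)"
    proof (rule Lim_transform_eventually[OF flat_exp_tendsto_0[of "Suc k"]])
      show "\<forall>\<^sub>F x in at_right 0. flat_exp (Suc k) x = flat_exp k x / x"
        by (auto simp: eventually_at_right_field flat_exp_def field_simps intro!: exI[of _ 1])
    qed
    moreover have "((\<lambda>h. flat_exp k h / h) \<longlongrightarrow> 0) (at_left 0)"
      by (rule tendsto_eventually)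
        (auto simp: eventually_at_left_field flat_exp_def intro!: exI[of _ "-1"])
    ultimately have "((\<lambda>h. flat_exp k h / h) \<longlongrightarrow> 0) (at 0)"
      by (simp add: filterlim_split_at)
    with 3 show ?thesis by (simp add: has_field_derivative_iff flat_exp_def)
  qed
qed

text \<open>The generators are chosen so that the set is closed under \<open>deriv\<close>.
  Membership then certifies infinite differentiability without any computation of iterated
  derivatives.\<close>

inductive_set flat_algebra :: "(real \<Rightarrow> real) set" where
  flat: "(\<lambda>x. flat_exp k (p * x + q)) \<in> flat_algebra"
| const: "(\<lambda>x. c) \<in> flat_algebra"
| add: "f \<in> flat_algebra \<Longrightarrow> g \<in> flat_algebra \<Longrightarrow> (\<lambda>x. f x + g x) \<in> flat_algebra"
| mult: "f \<in> flat_algebra \<Longrightarrow> g \<in> flat_algebra \<Longrightarrow> (\<lambda>x. f x * g x) \<in> flat_algebra"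

lemma flat_algebra_has_derivative:
  assumes "f \<in> flat_algebra"
  shows "\<exists>f'\<in>flat_algebra. \<forall>x. (f has_real_derivative f' x) (at x)"
  using assms
proof induction
  case (flat k p q)
  define f' where "f' x = p * flat_exp (k + 2) (p * x + q)
      + (- real k * p) * flat_exp (k + 1) (p * x + q)" for x
  have "f' \<in> flat_algebra"
    unfolding f'_def by (intro flat_algebra.intros)
  moreover have "((\<lambda>x. flat_exp k (p * x + q)) has_real_derivative f' x) (at x)" for x
    by (rule DERIV_chain2[OF flat_exp_has_derivative, THEN DERIV_cong])
      (auto intro!: derivative_eq_intros simp: f'_def algebra_simps)
  ultimately show ?case by blast
next
  case (const c)
  show ?case by (rule bexI[of _ "\<lambda>x. 0"]) (auto intro: flat_algebra.intros)
next
  case (add f g)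
  then obtain f' g' where "f' \<in> flat_algebra" "g' \<in> flat_algebra"
    "\<And>x. (f has_real_derivative f' x) (at x)" "\<And>x. (g has_real_derivative g' x) (at x)" by blast
  then show ?case
    by (intro bexI[of _ "\<lambda>x. f' x + g' x"]) (auto intro: flat_algebra.intros DERIV_add)
next
  case (mult f g)
  then obtain f' g' where "f' \<in> flat_algebra" "g' \<in> flat_algebra"
    "\<And>x. (f has_real_derivative f' x) (at x)" "\<And>x. (g has_real_derivative g' x) (at x)" by blast
  with mult(1,2) show ?case
    by (intro bexI[of _ "\<lambda>x. f' x * g x + g' x * f x"]) (auto intro: flat_algebra.intros DERIV_mult)
qed

lemma flat_algebra_deriv:
  assumes "f \<in> flat_algebra"
  shows "deriv f \<in> flat_algebra" "f differentiable at x"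
proof -
  obtain f' where f': "f' \<in> flat_algebra" "\<And>x. (f has_real_derivative f' x) (at x)"
    using flat_algebra_has_derivative[OF assms] by blast
  have "deriv f = f'" using f'(2) by (auto intro: DERIV_imp_deriv)
  with f' show "deriv f \<in> flat_algebra" "f differentiable at x"
    by (auto simp: real_differentiable_def)
qed

lemma flat_algebra_higher_differentiable:
  "f \<in> flat_algebra \<Longrightarrow> (deriv ^^ n) f differentiable at x"
proof (induction n arbitrary: f)
  case (Suc n)
  then show ?case
    unfolding funpow_Suc_right comp_def using flat_algebra_deriv by blast
qed (use flat_algebra_deriv in auto)

lemma flat_algebra_continuous: "f \<in> flat_algebra \<Longrightarrow> continuous_on S f"
  using flat_algebra_deriv(2) differentiable_imp_continuous_within
  by (metis continuous_at_imp_continuous_on)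

lemma closure_support_subset:
  fixes f :: "real \<Rightarrow> real"
  assumes "\<And>x. x \<notin> {c..d} \<Longrightarrow> f x = 0" "0 < c" "d < T"
  shows "closure {x. f x \<noteq> 0} \<subseteq> {0<..<T}"
proof -
  have "closure {x. f x \<noteq> 0} \<subseteq> {c..d}"
    by (rule closure_minimal) (use assms(1) in blast, simp)
  with assms show ?thesis by auto
qed

lemma flat_algebra_test_function:
  assumes "f \<in> flat_algebra" "\<And>x. x \<notin> {c..d} \<Longrightarrow> f x = 0" "0 < c" "d < T"
  shows "test_function T f"
  using flat_algebra_higher_differentiable[OF assms(1)] closure_support_subset[OF assms(2-4)]
  by (auto simp: test_function_def)

text \<open>The primitive from 0 vanishes before the support of \<open>f\<close> and, as the total
  integral is zero, also after it; its derivatives of positive order are \<open>f\<close> and the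
  derivatives of \<open>f\<close>. It supplies the test functions for the lemma of du
  Bois-Reymond.\<close>

lemma flat_algebra_antiderivative:
  assumes f: "f \<in> flat_algebra" and supp: "\<And>x. x \<notin> {c..d} \<Longrightarrow> f x = 0"
    and "0 < c" "c < d" "d < T" and "integral {0..T} f = 0"
  shows "\<exists>\<phi>. test_function T \<phi> \<and> deriv \<phi> = f"
proof -
  define \<phi> where "\<phi> t = integral {0..t} f" for t
  have cont: "continuous_on S f" for S by (rule flat_algebra_continuous[OF f])
  have int: "f integrable_on {x..y}" for x y by (rule integrable_continuous_real[OF cont])
  have zero_left: "\<phi> t = 0" if "t < c" for t
  proof -
    have "integral {0..t} f = integral {0..t} (\<lambda>x. 0)"
      by (rule integral_cong) (use supp that in auto)
    then show ?thesis by (simp add: \<phi>_def)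
  qed
  have zero_right: "\<phi> t = 0" if "t > d" for t
  proof -
    \<comment> \<open>Beyond \<open>d\<close> the primitive is constant; at \<open>T\<close> it is
      the full integral, so the constant is 0.\<close>
    have upto: "\<phi> s = \<phi> d" if "s > d" for s
    proof -
      have "integral {d..s} f = integral {d..s} (\<lambda>x. 0)"
        by (rule integral_spike[of "{d}"]) (use supp that in auto)
      moreover have "integral {0..s} f = integral {0..d} f + integral {d..s} f"
        by (rule Henstock_Kurzweil_Integration.integral_combine[symmetric])
          (use that assms int in auto)
      ultimately show ?thesis by (simp add: \<phi>_def)
    qed
    show ?thesis using upto[OF that] upto[OF assms(5)] assms(6) by (simp add: \<phi>_def)
  qed
  have deriv_\<phi>: "(\<phi> has_real_derivative f t) (at t)" for t
  proof (cases "t < c")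
    case True
    have "((\<lambda>t. 0) has_real_derivative f t) (at t)" using supp[of t] True by simp
    then show ?thesis
      by (rule has_field_derivative_transform_within_open[where S = "{..<c}"])
        (use True zero_left in auto)
  next
    case False
    \<comment> \<open>Here \<open>t \<ge> c > 0\<close>, so \<open>t\<close> is interior to the
      interval and the relative derivative is a full one.\<close>
    have "(\<phi> has_real_derivative f t) (at t within {0..t + 1})"
      unfolding \<phi>_def[abs_def] by (rule integral_has_real_derivative[OF cont]) (use False assms in auto)
    then have "(\<phi> has_real_derivative f t) (at t within {0<..<t + 1})"
      by (rule has_field_derivative_subset) auto
    then show ?thesis using False assms(3) by (subst (asm) at_within_open) auto
  qed
  then have d\<phi>: "deriv \<phi> = f" by (auto intro: DERIV_imp_deriv)
  have "(deriv ^^ n) \<phi> differentiable at x" for n x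
  proof (cases n)
    case 0
    then show ?thesis using deriv_\<phi> by (auto simp: real_differentiable_def)
  next
    case (Suc m)
    then show ?thesis
      using flat_algebra_higher_differentiable[OF f] d\<phi> by (simp add: funpow_Suc_right del: funpow.simps)
  qed
  moreover have "closure {x. \<phi> x \<noteq> 0} \<subseteq> {0<..<T}"
    by (rule closure_support_subset[of c d]) (use zero_left zero_right assms in auto)
  ultimately show ?thesis using d\<phi> unfolding test_function_def by blast
qed

text \<open>The factor \<open>n\<close> steepens the flanks without moving the support: exp(-1/(n
  y)) tends to 1 for every y > 0. The bumps thus converge pointwise to the indicator of (c,d) while
  staying between 0 and 1.\<close>

definition bump :: "nat \<Rightarrow> real \<Rightarrow> real \<Rightarrow> real \<Rightarrow> real" where
  "bump n c d x = flat_exp 0 (real n * x + (- real n * c)) * flat_exp 0 (- real n * x + real n * d)"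

lemma bump_in_flat_algebra: "bump n c d \<in> flat_algebra"
  unfolding bump_def[abs_def] by (intro flat_algebra.intros)

lemma bump_eq_0:
  assumes "x \<notin> {c<..<d}"
  shows "bump n c d x = 0"
proof -
  have "real n * x \<le> real n * c \<or> real n * d \<le> real n * x"
    using assms by (auto simp: not_less intro: mult_left_mono)
  then show ?thesis by (auto simp: bump_def flat_exp_def)
qed

lemma bump_range: "0 \<le> bump n c d x" "bump n c d x \<le> 1"
proof -
  have "0 \<le> flat_exp 0 y \<and> flat_exp 0 y \<le> 1" for y
    by (simp add: flat_exp_def field_simps)
  then show "0 \<le> bump n c d x" "bump n c d x \<le> 1"
    by (simp_all add: bump_def mult_le_one)
qed

lemma bump_tendsto: "(\<lambda>n. bump n c d x) \<longlonglongrightarrow> indicator {c<..<d} x"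
proof (cases "x \<in> {c<..<d}")
  case True
  have *: "(\<lambda>n. flat_exp 0 (real n * y)) \<longlonglongrightarrow> 1" if "y > 0" for y
  proof -
    have "(\<lambda>n. inverse (real n)) \<longlonglongrightarrow> 0" by (rule lim_inverse_n)
    then have "(\<lambda>n. 1 / exp (inverse (real n) * inverse y)) \<longlonglongrightarrow> 1 / exp (0 * inverse y)"
      by (intro tendsto_intros) auto
    then have "(\<lambda>n. 1 / exp (inverse (real n) * inverse y)) \<longlonglongrightarrow> 1" by simp
    then show ?thesis
      by (rule Lim_transform_eventually)
        (use that in \<open>auto simp: flat_exp_def eventually_sequentially intro!: exI[of _ 1]\<close>)
  qed
  have "(\<lambda>n. flat_exp 0 (real n * (x - c)) * flat_exp 0 (real n * (d - x))) \<longlonglongrightarrow> 1 * 1"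
    by (intro tendsto_mult *) (use True in auto)
  then show ?thesis using True by (simp add: bump_def algebra_simps)
next
  case False
  then have "bump n c d x = 0" for n by (rule bump_eq_0)
  with False show ?thesis by simp
qed

text \<open>A continuous non-negative function with integral zero vanishes identically, but this one
  is positive at the midpoint.\<close>

lemma integral_bump_pos:
  assumes "c < d"
  shows "integral {c..d} (bump 1 c d) > 0"
proof -
  have cont: "continuous_on {c..d} (bump 1 c d)"
    by (rule flat_algebra_continuous[OF bump_in_flat_algebra])
  have "integral {c..d} (bump 1 c d) \<noteq> 0"
  proof
    assume "integral {c..d} (bump 1 c d) = 0"
    then have "(bump 1 c d has_integral 0) (cbox c d)"
      using integrable_integral[OF integrable_continuous_real[OF cont]] by simp
    then have "bump 1 c d ((c + d) / 2) = 0"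
      by (rule has_integral_0_cbox_imp_0[rotated 2]) (use cont bump_range assms in auto)
    with assms show False by (auto simp: bump_def flat_exp_def field_simps)
  qed
  moreover have "integral {c..d} (bump 1 c d) \<ge> 0"
    by (rule integral_nonneg[OF integrable_continuous_real[OF cont]]) (simp add: bump_range)
  ultimately show ?thesis by simp
qed

subsection \<open>Primitives and integration by parts\<close>

lemma finite_measure_time: "finite_measure (time_measure T)"
  by (rule finite_measure_lebesgue_on) auto

lemma ident_measurable_time: "(\<lambda>t. t) \<in> time_measure T \<rightarrow>\<^sub>M borel"
  using id_borel_measurable_lebesgue_on[of "{0<..<T}"] by (simp add: id_def)

lemma borel_measurable_time:
  "f \<in> borel \<rightarrow>\<^sub>M N \<Longrightarrow> f \<in> time_measure T \<rightarrow>\<^sub>M N"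
  using measurable_compose[OF ident_measurable_time] by fast

lemma AE_time_neq: "AE s in time_measure T. s \<noteq> t"
proof -
  have "AE s in lebesgue. s \<noteq> t"
    by (rule AE_I'[of "{t}"]) auto
  then show ?thesis by (auto simp: AE_restrict_space_iff elim: eventually_mono)
qed

text \<open>The integral of \<open>f\<close> from 0 to \<open>t\<close>. Writing it with an
  indicator over a fixed measure space suits Fubini and dominated convergence and makes it total in
  \<open>t\<close>: it is 0 for \<open>t \<le> 0\<close> and the full integral for
  \<open>t \<ge> T\<close>.\<close>

definition prim :: "real \<Rightarrow> (real \<Rightarrow> 'a::{banach, second_countable_topology}) \<Rightarrow> real \<Rightarrow> 'a" where
  "prim T f t = (LINT s|time_measure T. indicator {..t} s *\<^sub>R f s)"

context
  fixes T :: real and f :: "real \<Rightarrow> 'a::{banach, second_countable_topology}"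
  assumes f: "integrable (time_measure T) f"
begin

lemma integrable_indicator_time:
  "A \<in> sets borel \<Longrightarrow> integrable (time_measure T) (\<lambda>s. indicator A s *\<^sub>R f s)"
  by (rule Bochner_Integration.integrable_bound[OF f])
    (auto simp: indicator_def intro!: borel_measurable_scaleR borel_measurable_integrable[OF f]
      borel_measurable_time[OF borel_measurable_indicator, unfolded indicator_def])

lemma norm_prim_le: "norm (prim T f t) \<le> (LINT s|time_measure T. norm (f s))"
  unfolding prim_def
  by (rule order_trans[OF integral_norm_bound], rule integral_mono[OF integrable_norm[OF integrable_indicator_time]])
    (auto intro!: integrable_norm integrable_indicator_time f mult_left_le_one_le)

text \<open>Dominated convergence: the indicators converge at every \<open>s\<close> other than
  \<open>t\<close>, which is a null set.\<close>

lemma continuous_on_prim: "continuous_on S (prim T f)"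
proof (rule continuous_at_imp_continuous_on, intro ballI)
  fix t assume "t \<in> S"
  show "isCont (prim T f) t"
    unfolding continuous_at_sequentially comp_def
  proof (intro allI impI)
    fix x :: "nat \<Rightarrow> real" assume x: "x \<longlonglongrightarrow> t"
    show "(\<lambda>n. prim T f (x n)) \<longlonglongrightarrow> prim T f t"
      unfolding prim_def
    proof (rule integral_dominated_convergence[where w = "\<lambda>s. norm (f s)"])
      show "AE s in time_measure T. (\<lambda>i. indicat_real {..x i} s *\<^sub>R f s) \<longlonglongrightarrow> indicat_real {..t} s *\<^sub>R f s"
        using AE_time_neq[of t T]
      proof eventually_elim
        case (elim s)
        then consider "s < t" | "t < s" by linarith
        then show ?case
        proof cases
          case 1
          have "\<forall>\<^sub>F i in sequentially. indicat_real {..t} s *\<^sub>R f s = indicat_real {..x i} s *\<^sub>R f s"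
            using order_tendstoD(1)[OF x 1] by (rule eventually_mono) (use 1 in auto)
          then show ?thesis by (rule Lim_transform_eventually[OF tendsto_const])
        next
          case 2
          have "\<forall>\<^sub>F i in sequentially. indicat_real {..t} s *\<^sub>R f s = indicat_real {..x i} s *\<^sub>R f s"
            using order_tendstoD(2)[OF x 2] by (rule eventually_mono) (use 2 in auto)
          then show ?thesis by (rule Lim_transform_eventually[OF tendsto_const])
        qed
      qed
    qed (use f in \<open>auto simp: mult_left_le_one_le
          intro!: integrable_norm borel_measurable_integrable integrable_indicator_time\<close>)
  qed
qed

lemma integral_atLeast_eq_diff_prim:
  "(LINT s|time_measure T. indicator {t..} s *\<^sub>R f s) = (LINT s|time_measure T. f s) - prim T f t"
proof -
  have "(LINT s|time_measure T. indicator {t..} s *\<^sub>R f s)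
      = (LINT s|time_measure T. f s - indicator {..t} s *\<^sub>R f s)"
  proof (rule integral_cong_AE)
    show "AE s in time_measure T. indicator {t..} s *\<^sub>R f s = f s - indicator {..t} s *\<^sub>R f s"
      using AE_time_neq[of t T] by eventually_elim (auto simp: indicator_def)
  qed (use f in \<open>auto intro!: borel_measurable_diff borel_measurable_integrable integrable_indicator_time\<close>)
  then show ?thesis
    using f by (simp add: prim_def Bochner_Integration.integral_diff integrable_indicator_time)
qed

end


lemma prim_0: "prim T f 0 = 0"
proof -
  have "prim T f 0 = (LINT s|time_measure T. 0)"
    unfolding prim_def by (rule Bochner_Integration.integral_cong) (auto simp: space_restrict_space)
  then show ?thesis by simp
qed

context
  fixes prod :: "'a::{banach, second_countable_topology} \<Rightarrow> 'b::{banach, second_countable_topology}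
      \<Rightarrow> 'c::{banach, second_countable_topology}"
  assumes prod: "bounded_bilinear prod"
begin

interpretation prod: bounded_bilinear prod by (rule prod)

lemma borel_measurable_bilinear:
  "f \<in> borel_measurable M \<Longrightarrow> g \<in> borel_measurable M \<Longrightarrow> (\<lambda>x. prod (f x) (g x)) \<in> borel_measurable M"
  by (rule borel_measurable_continuous_Pair)
    (auto intro!: bounded_bilinear.continuous_on[OF prod] continuous_intros)

lemma integrable_bilinear_bounded_right:
  assumes "integrable M f" "g \<in> borel_measurable M" "\<And>x. x \<in> space M \<Longrightarrow> norm (g x) \<le> C"
  shows "integrable M (\<lambda>x. prod (f x) (g x))"
proof -
  obtain K where K: "\<And>x y. norm (prod x y) \<le> norm x * norm y * K" "K > 0"
    using prod.pos_bounded by auto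
  show ?thesis
  proof (rule Bochner_Integration.integrable_bound)
    show "integrable M (\<lambda>x. norm (f x) * (C * K))" using assms(1) by simp
    show "(\<lambda>x. prod (f x) (g x)) \<in> borel_measurable M"
      using assms by (intro borel_measurable_bilinear) auto
    show "AE x in M. norm (prod (f x) (g x)) \<le> norm (norm (f x) * (C * K))"
    proof (rule AE_I2)
      fix x assume "x \<in> space M"
      have "norm (prod (f x) (g x)) \<le> norm (f x) * norm (g x) * K" by (rule K)
      also have "\<dots> \<le> norm (f x) * C * K"
        using K(2) assms(3)[OF \<open>x \<in> space M\<close>] by (intro mult_right_mono mult_left_mono) auto
      also have "\<dots> \<le> norm (norm (f x) * (C * K))" by (simp add: mult.assoc)
      finally show "norm (prod (f x) (g x)) \<le> norm (norm (f x) * (C * K))" .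
    qed
  qed
qed

end

text \<open>Opened anew so that the preceding facts are available for arbitrary products:
  integration by parts needs them for the flipped product, whose argument types are
  exchanged.\<close>

context
  fixes prod :: "'a::{banach, second_countable_topology} \<Rightarrow> 'b::{banach, second_countable_topology}
      \<Rightarrow> 'c::{banach, second_countable_topology}"
  assumes prod: "bounded_bilinear prod"
begin

interpretation prod: bounded_bilinear prod by (rule prod)

lemma integrable_bilinear_product:
  assumes f: "integrable (time_measure T) f" and g: "integrable (time_measure T) g"
  shows "integrable (time_measure T \<Otimes>\<^sub>M time_measure T) (\<lambda>(x, y). prod (f x) (g y))"
proof -
  interpret M: finite_measure "time_measure T" by (rule finite_measure_time)
  interpret P: pair_sigma_finite "time_measure T" "time_measure T" ..
  obtain K where K: "\<And>x y. norm (prod x y) \<le> norm x * norm y * K" "K > 0"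
    using prod.pos_bounded by auto
  have fm: "(\<lambda>z. f (fst z)) \<in> borel_measurable (time_measure T \<Otimes>\<^sub>M time_measure T)"
    and gm: "(\<lambda>z. g (snd z)) \<in> borel_measurable (time_measure T \<Otimes>\<^sub>M time_measure T)"
    using measurable_compose[OF measurable_fst borel_measurable_integrable[OF f]]
      measurable_compose[OF measurable_snd borel_measurable_integrable[OF g]] by auto
  have "integrable (time_measure T \<Otimes>\<^sub>M time_measure T) (\<lambda>z. norm (f (fst z)) * norm (g (snd z)))"
  proof (rule P.Fubini_integrable)
    show "(\<lambda>z. norm (f (fst z)) * norm (g (snd z))) \<in> borel_measurable (time_measure T \<Otimes>\<^sub>M time_measure T)"
      using fm gm by measurable
  qed (use f g in auto)
  then have "integrable (time_measure T \<Otimes>\<^sub>M time_measure T) (\<lambda>z. norm (f (fst z)) * norm (g (snd z)) * K)"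
    by simp
  then have "integrable (time_measure T \<Otimes>\<^sub>M time_measure T) (\<lambda>z. prod (f (fst z)) (g (snd z)))"
    by (rule Bochner_Integration.integrable_bound)
      (use borel_measurable_bilinear[OF prod fm gm] K in \<open>auto simp: abs_mult\<close>)
  then show ?thesis by (simp add: case_prod_beta')
qed

text \<open>The product of the two integrals is a double integral over a square, and the two terms
  are its halves on either side of the diagonal. Over the triangle \<open>y \<le> x\<close>,
  integrating in \<open>y\<close> first produces \<open>prim T g\<close>; integrating in
  \<open>x\<close> first produces the tail of \<open>f\<close>, which is its total integral minus
  \<open>prim T f\<close>.\<close>

lemma integral_by_parts:
  assumes f: "integrable (time_measure T) f" and g: "integrable (time_measure T) g"
  shows "prod (LINT t|time_measure T. f t) (LINT t|time_measure T. g t) =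
    (LINT t|time_measure T. prod (f t) (prim T g t)) + (LINT t|time_measure T. prod (prim T f t) (g t))"
proof -
  let ?M = "time_measure T"
  interpret M: finite_measure ?M by (rule finite_measure_time)
  interpret P: pair_sigma_finite ?M ?M ..
  define F where "F x y = indicat_real {..x} y *\<^sub>R prod (f x) (g y)" for x y
  have [measurable]: "(\<lambda>x. x) \<in> ?M \<rightarrow>\<^sub>M borel" by (rule ident_measurable_time)
  have "integrable (?M \<Otimes>\<^sub>M ?M) (\<lambda>z. prod (f (fst z)) (g (snd z)))"
    using integrable_bilinear_product[OF f g] by (simp add: case_prod_beta')
  moreover have "{z \<in> space (?M \<Otimes>\<^sub>M ?M). snd z \<le> fst z} \<in> sets (?M \<Otimes>\<^sub>M ?M)"
    by measurable
  ultimately have "integrable (?M \<Otimes>\<^sub>M ?M) (\<lambda>z. indicator {z \<in> space (?M \<Otimes>\<^sub>M ?M). snd z \<le> fst z} z *\<^sub>R prod (f (fst z)) (g (snd z)))"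
    by (intro integrable_mult_indicator)
  then have int: "integrable (?M \<Otimes>\<^sub>M ?M) (case_prod F)"
    by (rule Bochner_Integration.integrable_cong[THEN iffD1, rotated 2])
      (auto simp: F_def case_prod_beta' indicator_def)
  have "(LINT t|?M. prod (f t) (prim T g t)) = (LINT x|?M. LINT y|?M. F x y)"
    by (simp add: prim_def F_def prod.scaleR_right[symmetric]
      integral_bounded_linear[OF prod.bounded_linear_right integrable_indicator_time[OF g]])
  also have "\<dots> = (LINT y|?M. LINT x|?M. F x y)"
    using P.Fubini_integral[OF int] by simp
  also have "\<dots> = (LINT y|?M. prod (LINT x|?M. indicator {y..} x *\<^sub>R f x) (g y))"
  proof -
    have "F x y = prod (indicator {y..} x *\<^sub>R f x) (g y)" for x y
      by (simp add: F_def prod.scaleR_left indicator_def)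
    then show ?thesis
      by (simp add: integral_bounded_linear[OF prod.bounded_linear_left integrable_indicator_time[OF f]])
  qed
  also have "\<dots> = (LINT y|?M. prod (LINT x|?M. f x) (g y) - prod (prim T f y) (g y))"
    by (simp add: integral_atLeast_eq_diff_prim[OF f] prod.diff_left)
  also have "\<dots> = (LINT y|?M. prod (LINT x|?M. f x) (g y)) - (LINT y|?M. prod (prim T f y) (g y))"
  proof (rule Bochner_Integration.integral_diff)
    show "integrable ?M (\<lambda>x. prod (integral\<^sup>L ?M f) (g x))"
      by (rule integrable_bounded_linear[OF prod.bounded_linear_right g])
    show "integrable ?M (\<lambda>x. prod (prim T f x) (g x))"
    proof -
      have "prim T f \<in> borel_measurable ?M"
        by (intro borel_measurable_time borel_measurable_continuous_onI continuous_on_prim f)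
      then show ?thesis
        by (rule integrable_bilinear_bounded_right[OF prod.flip g _ norm_prim_le[OF f]])
    qed
  qed
  also have "(LINT y|?M. prod (LINT x|?M. f x) (g y)) = prod (LINT x|?M. f x) (LINT y|?M. g y)"
    by (rule integral_bounded_linear[OF prod.bounded_linear_right g])
  finally show ?thesis by simp
qed

end

subsection \<open>Weak derivatives and primitives\<close>

lemma integrable_continuous_time:
  fixes f :: "real \<Rightarrow> real"
  assumes "continuous_on UNIV f"
  shows "integrable (time_measure T) f"
    and "(LINT t|time_measure T. f t) = integral {0..T} f"
proof -
  have "f absolutely_integrable_on {0..T}"
    by (rule absolutely_integrable_continuous_real) (rule continuous_on_subset[OF assms], simp)
  then have "f absolutely_integrable_on {0<..<T}"
    by (rule set_integrable_subset) auto
  then show i: "integrable (time_measure T) f"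
    by (simp add: integrable_restrict_space set_integrable_def)
  show "(LINT t|time_measure T. f t) = integral {0..T} f"
    using lebesgue_integral_eq_integral[OF i] by (simp add: integral_open_interval_real)
qed

text \<open>Increments of the primitive are the given integrals, so it is constant on the open
  interval; continuity extends this to the endpoints, and the value at 0 fixes the constant.\<close>

lemma prim_eq_0_if_interval_integrals_eq_0:
  fixes f :: "real \<Rightarrow> 'a::{banach, second_countable_topology}"
  assumes f: "integrable (time_measure T) f" and "T > 0"
    and 0: "\<And>c d. 0 < c \<Longrightarrow> c < d \<Longrightarrow> d < T \<Longrightarrow>
      (LINT t|time_measure T. indicator {c<..<d} t *\<^sub>R f t) = 0"
  shows "prim T f t = 0"
proof -
  have step: "prim T f d = prim T f c" if "0 < c" "c < d" "d < T" for c d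
  proof -
    have "prim T f d - prim T f c =
      (LINT t|time_measure T. indicator {..d} t *\<^sub>R f t - indicator {..c} t *\<^sub>R f t)"
      unfolding prim_def by (simp add: Bochner_Integration.integral_diff integrable_indicator_time[OF f])
    also have "\<dots> = (LINT t|time_measure T. indicator {c<..<d} t *\<^sub>R f t)"
    proof (rule integral_cong_AE)
      show "AE t in time_measure T. indicator {..d} t *\<^sub>R f t - indicator {..c} t *\<^sub>R f t
          = indicator {c<..<d} t *\<^sub>R f t"
        using AE_time_neq[of d T] by eventually_elim (use that in \<open>auto simp: indicator_def\<close>)
    qed (auto intro!: borel_measurable_diff borel_measurable_integrable integrable_indicator_time f)
    finally show ?thesis using 0[OF that] by simp
  qed
  obtain h where h: "0 < h" "h < T" using dense[OF \<open>T > 0\<close>] by blast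
  have const: "prim T f t = prim T f h" if "t \<in> {0..T}" for t
  proof -
    have "prim T f x = prim T f h" if "x \<in> {0<..<T}" for x
      using step[of x h] step[of h x] h that by (cases x h rule: linorder_cases) auto
    then show ?thesis
      using continuous_constant_on_closure[of "{0<..<T}" "prim T f" "prim T f h" t]
        continuous_on_prim[OF f] that \<open>T > 0\<close> by simp
  qed
  have "prim T f t = 0" if "t \<in> {0..T}" for t
    using const[of t] const[of 0] prim_0[of T f] that \<open>T > 0\<close> by simp
  moreover have "prim T f t = prim T f 0" if "t < 0"
    unfolding prim_def using that
    by (intro Bochner_Integration.integral_cong) (auto simp: space_restrict_space indicator_def)
  moreover have "prim T f t = prim T f T" if "t > T"
    unfolding prim_def using that
    by (intro Bochner_Integration.integral_cong) (auto simp: space_restrict_space indicator_def)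
  ultimately show ?thesis using \<open>T > 0\<close>
    by (cases "t < 0"; cases "t > T") auto
qed

text \<open>The half-lines form an intersection-stable generator of the Borel sets, and the sets
  over which \<open>f\<close> integrates to 0 are closed under complements and countable disjoint
  unions. A function whose integral over every measurable set is 0 vanishes almost
  everywhere.\<close>

lemma AE_eq_0_if_prim_eq_0:
  fixes f :: "real \<Rightarrow> 'a::{banach, second_countable_topology}"
  assumes f: "integrable (time_measure T) f" and 0: "\<And>t. prim T f t = 0"
  shows "AE t in time_measure T. f t = 0"
proof (rule sigma_finite_measure.density_zero[OF finite_measure.axioms(1)[OF finite_measure_time] f])
  have total: "(LINT t|time_measure T. f t) = 0"
  proof -
    have "(LINT t|time_measure T. f t) = prim T f T"
      unfolding prim_def
      by (intro Bochner_Integration.integral_cong) (auto simp: space_restrict_space indicator_def)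
    then show ?thesis using 0 by simp
  qed
  have borel: "(LINT t|time_measure T. indicator A t *\<^sub>R f t) = 0" if "A \<in> sets borel" for A
  proof -
    have "Int_stable (range atMost :: real set set)" by (auto simp: Int_stable_def)
    moreover have "range atMost \<subseteq> Pow (UNIV :: real set)" by simp
    moreover have "A \<in> sigma_sets UNIV (range atMost)"
      using that by (simp add: borel_eq_atMost)
    ultimately show ?thesis
    proof (induct rule: sigma_sets_induct_disjoint)
      case (basic A)
      then show ?case using 0 by (auto simp: prim_def)
    next
      case empty
      then show ?case by simp
    next
      case (compl A)
      have A: "A \<in> sets borel" using compl(1) by (simp add: borel_eq_atMost)
      have "(LINT t|time_measure T. indicator (UNIV - A) t *\<^sub>R f t)
          = (LINT t|time_measure T. f t - indicator A t *\<^sub>R f t)"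
        by (intro Bochner_Integration.integral_cong) (auto simp: indicator_def)
      also have "\<dots> = 0"
        using total compl f A
        by (simp add: Bochner_Integration.integral_diff integrable_indicator_time)
      finally show ?case .
    next
      case (union A)
      have A: "A i \<in> sets borel" for i using union(2) by (auto simp: borel_eq_atMost)
      \<comment> \<open>Countable additivity is applied in the restricted measure space, whose
        measurable sets lie in (0,T).\<close>
      define B where "B i = A i \<inter> {0<..<T}" for i
      have B: "B i \<in> sets (time_measure T)" for i
        using A[of i] by (simp add: B_def sets_restrict_space_iff)
      have eq: "(LINT t|time_measure T. indicator (C \<inter> {0<..<T}) t *\<^sub>R f t)
          = (LINT t|time_measure T. indicator C t *\<^sub>R f t)" for C
        by (intro Bochner_Integration.integral_cong) (auto simp: space_restrict_space indicator_def)
      have "(LINT t:(\<Union>i. B i)|time_measure T. f t) = (\<Sum>i. (LINT t:(B i)|time_measure T. f t))"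
      proof (rule lebesgue_integral_countable_add[OF B])
        show "B i \<inter> B j = {}" if "i \<noteq> j" for i j
          using union(1) that by (auto simp: B_def disjoint_family_on_def)
        show "set_integrable (time_measure T) (\<Union>i. B i) f"
          unfolding set_integrable_def by (rule integrable_mult_indicator) (use B f in auto)
      qed
      also have "\<dots> = 0" using union(3) by (simp add: set_lebesgue_integral_def B_def eq)
      also have "(\<Union>i. B i) = (\<Union>i. A i) \<inter> {0<..<T}" by (auto simp: B_def)
      finally show ?case by (simp add: set_lebesgue_integral_def eq)
    qed
  qed
  show "set_lebesgue_integral (time_measure T) A f = 0" if A: "A \<in> sets (time_measure T)" for A
  proof -
    \<comment> \<open>The induction reached Borel sets only; a Lebesgue set is a Borel set up to a
      null set.\<close>
    have "A \<in> sets lebesgue" using A by (auto simp: sets_restrict_space)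
    then obtain S N N' where S: "A = S \<union> N" "N \<subseteq> N'" "N' \<in> null_sets lborel" "S \<in> sets lborel"
      by (rule sets_completionE)
    have "AE t in lebesgue. t \<notin> N'"
      by (rule AE_not_in) (use S null_sets_completionI in blast)
    then have "AE t in time_measure T. t \<notin> N'"
      by (auto simp: AE_restrict_space_iff elim: eventually_mono)
    then have ae: "AE t in time_measure T. indicator A t *\<^sub>R f t = indicator S t *\<^sub>R f t"
      by eventually_elim (use S in \<open>auto simp: indicator_def\<close>)
    have "(LINT t|time_measure T. indicator A t *\<^sub>R f t) = (LINT t|time_measure T. indicator S t *\<^sub>R f t)"
      by (rule integral_cong_AE[OF borel_measurable_integrable[OF integrable_mult_indicator[OF A f]]
          borel_measurable_integrable[OF integrable_indicator_time[OF f]] ae]) (use S in simp)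
    then show ?thesis using borel[of S] S by (simp add: set_lebesgue_integral_def)
  qed
qed

text \<open>The fundamental lemma of the calculus of variations, tested with bumps alone: they
  converge boundedly to indicators of intervals.\<close>

lemma AE_eq_0_if_bump_integrals_eq_0:
  fixes f :: "real \<Rightarrow> 'a::{banach, second_countable_topology}"
  assumes f: "integrable (time_measure T) f" and "T > 0"
    and 0: "\<And>n c d. 0 < c \<Longrightarrow> c < d \<Longrightarrow> d < T \<Longrightarrow> (LINT t|time_measure T. bump n c d t *\<^sub>R f t) = 0"
  shows "AE t in time_measure T. f t = 0"
proof (rule AE_eq_0_if_prim_eq_0[OF f], rule prim_eq_0_if_interval_integrals_eq_0[OF f \<open>T > 0\<close>])
  fix c d assume cd: "0 < c" "c < d" "d < T"
  have "(\<lambda>n. LINT t|time_measure T. bump n c d t *\<^sub>R f t)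
      \<longlonglongrightarrow> (LINT t|time_measure T. indicator {c<..<d} t *\<^sub>R f t)"
  proof (rule integral_dominated_convergence[where w = "\<lambda>t. norm (f t)"])
    show "AE t in time_measure T. (\<lambda>n. bump n c d t *\<^sub>R f t) \<longlonglongrightarrow> indicator {c<..<d} t *\<^sub>R f t"
      by (intro AE_I2 tendsto_scaleR bump_tendsto tendsto_const)
    show "(\<lambda>t. bump n c d t *\<^sub>R f t) \<in> borel_measurable (time_measure T)" for n
      by (intro borel_measurable_scaleR borel_measurable_time borel_measurable_continuous_onI
          flat_algebra_continuous bump_in_flat_algebra borel_measurable_integrable f)
    show "AE t in time_measure T. norm (bump n c d t *\<^sub>R f t) \<le> norm (f t)" for n
      by (simp add: bump_range mult_left_le_one_le)
  qed (rule borel_measurable_integrable[OF integrable_indicator_time[OF f]], simp,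
      rule integrable_norm[OF f])
  moreover have "(\<lambda>n. LINT t|time_measure T. bump n c d t *\<^sub>R f t) = (\<lambda>n. 0)"
    using 0[OF cd] by (rule ext)
  ultimately show "(LINT t|time_measure T. indicator {c<..<d} t *\<^sub>R f t) = 0"
    by (simp only: LIMSEQ_const_iff)
qed

lemma integrable_scaleR_continuous:
  fixes f :: "real \<Rightarrow> 'a::{banach, second_countable_topology}"
  assumes "integrable (time_measure T) f" "continuous_on UNIV \<phi>"
  shows "integrable (time_measure T) (\<lambda>t. \<phi> t *\<^sub>R f t)"
proof -
  have "bounded (\<phi> ` {0..T})"
    by (rule compact_imp_bounded[OF compact_continuous_image[OF continuous_on_subset[OF assms(2)]]]) auto
  then obtain C where C: "\<And>t. t \<in> {0..T} \<Longrightarrow> norm (\<phi> t) \<le> C"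
    unfolding bounded_iff by (auto simp del: atLeastAtMost_iff)
  show ?thesis
  proof (rule integrable_bilinear_bounded_right[OF bounded_bilinear.flip[OF bounded_bilinear_scaleR] assms(1)])
    show "\<phi> \<in> borel_measurable (time_measure T)"
      by (intro borel_measurable_time borel_measurable_continuous_onI assms(2))
    show "norm (\<phi> t) \<le> C" if "t \<in> space (time_measure T)" for t
      by (rule C) (use that in \<open>auto simp: space_restrict_space\<close>)
  qed
qed

text \<open>A bump has positive mean and so is not the derivative of a test function. Subtracting a
  multiple of one fixed bump \<open>b0\<close> removes the mean; the price is the constant, which is
  subtracted from \<open>f\<close> before the fundamental lemma is applied.\<close>

lemma du_Bois_Reymond:
  fixes f :: "real \<Rightarrow> 'a::{banach, second_countable_topology}"
  assumes f: "integrable (time_measure T) f" and "T > 0"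
    and 0: "\<And>\<phi>. test_function T \<phi> \<Longrightarrow> (LINT t|time_measure T. deriv \<phi> t *\<^sub>R f t) = 0"
  shows "\<exists>c. AE t in time_measure T. f t = c"
proof -
  let ?M = "time_measure T"
  interpret finite_measure ?M by (rule finite_measure_time)
  define I where "I \<psi> = integral {0..T} \<psi>" for \<psi> :: "real \<Rightarrow> real"
  define b0 where "b0 = bump 1 (T/3) (2*T/3)"
  have b0: "b0 \<in> flat_algebra" by (simp add: b0_def bump_in_flat_algebra)
  have "I b0 > 0"
  proof -
    have "integral {T/3..2*T/3} b0 \<le> I b0"
      unfolding I_def
      by (rule integral_subset_le)
        (use \<open>T > 0\<close> in \<open>auto simp: b0_def bump_range
          intro!: integrable_continuous_real flat_algebra_continuous bump_in_flat_algebra\<close>)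
    then show ?thesis using integral_bump_pos[of "T/3" "2*T/3"] \<open>T > 0\<close> by (simp add: b0_def)
  qed
  \<comment> \<open>The only candidate for the constant: the mean of \<open>f\<close> with respect
    to the weight \<open>b0\<close>, normalised to total mass 1.\<close>
  define C where "C = (1 / I b0) *\<^sub>R (LINT t|?M. b0 t *\<^sub>R f t)"
  have "AE t in ?M. f t - C = 0"
  proof (rule AE_eq_0_if_bump_integrals_eq_0[OF _ \<open>T > 0\<close>])
    fix n c d assume cd: "0 < c" "c < d" "d < T"
    let ?b = "bump n c d"
    define \<psi> where "\<psi> t = ?b t + (- I ?b / I b0) * b0 t" for t
    have cont: "continuous_on S \<psi>" "continuous_on S b0" "continuous_on S ?b" for S
      unfolding \<psi>_def[abs_def]
      by (rule flat_algebra_continuous, intro flat_algebra.intros bump_in_flat_algebra b0)+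
    have "\<exists>\<phi>. test_function T \<phi> \<and> deriv \<phi> = \<psi>"
    proof (rule flat_algebra_antiderivative)
      show "\<psi> \<in> flat_algebra"
        unfolding \<psi>_def[abs_def] by (intro flat_algebra.intros bump_in_flat_algebra b0)
      show "\<psi> x = 0" if "x \<notin> {min c (T/3)..max d (2*T/3)}" for x
      proof -
        have "x \<notin> {c<..<d}" "x \<notin> {T/3<..<2*T/3}" using that by auto
        then show ?thesis by (simp add: \<psi>_def b0_def bump_eq_0)
      qed
      have int: "?b integrable_on {0..T}" "b0 integrable_on {0..T}"
        by (intro integrable_continuous_real cont)+
      have "(\<psi> has_integral I ?b + (- I ?b / I b0) * I b0) {0..T}"
        unfolding \<psi>_def[abs_def] I_def
        by (intro has_integral_add has_integral_mult_right integrable_integral int)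
      then have "integral {0..T} \<psi> = I ?b + (- I ?b / I b0) * I b0" by (rule integral_unique)
      then show "integral {0..T} \<psi> = 0" using \<open>I b0 > 0\<close> by simp
    qed (use cd \<open>T > 0\<close> in auto)
    then have "(LINT t|?M. \<psi> t *\<^sub>R f t) = 0" using 0 by auto
    moreover have "(LINT t|?M. \<psi> t *\<^sub>R f t) =
        (LINT t|?M. ?b t *\<^sub>R f t) + (LINT t|?M. (- I ?b / I b0) *\<^sub>R (b0 t *\<^sub>R f t))"
      unfolding \<psi>_def scaleR_add_left scaleR_scaleR[symmetric]
      by (rule Bochner_Integration.integral_add)
        (intro integrable_scaleR_continuous f cont integrable_scaleR_right)+
    ultimately have "(LINT t|?M. ?b t *\<^sub>R f t) = I ?b *\<^sub>R C"
      by (simp add: C_def del: scaleR_scaleR scaleR_left_diff_distrib) (simp add: mult.commute)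
    moreover have "(LINT t|?M. ?b t *\<^sub>R C) = I ?b *\<^sub>R C"
      using integrable_continuous_time[OF cont(3)] by (simp add: I_def)
    moreover have "(LINT t|?M. ?b t *\<^sub>R (f t - C)) = (LINT t|?M. ?b t *\<^sub>R f t) - (LINT t|?M. ?b t *\<^sub>R C)"
      unfolding scaleR_diff_right
      by (intro Bochner_Integration.integral_diff integrable_scaleR_continuous f cont
          integrable_scaleR_left integrable_continuous_time)
    ultimately show "(LINT t|?M. ?b t *\<^sub>R (f t - C)) = 0" by simp
  qed (use f in auto)
  then show ?thesis by auto
qed

context
  fixes T \<phi> assumes \<phi>: "test_function T \<phi>"
begin

lemma test_function_has_derivative: "(\<phi> has_real_derivative deriv \<phi> t) (at t)"
proof -
  have "(deriv ^^ 0) \<phi> differentiable at t" using \<phi> unfolding test_function_def by blast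
  then show ?thesis by (simp add: DERIV_deriv_iff_real_differentiable)
qed

lemma test_function_continuous: "continuous_on S \<phi>" "continuous_on S (deriv \<phi>)"
proof -
  have "(deriv ^^ 0) \<phi> differentiable at t" "(deriv ^^ Suc 0) \<phi> differentiable at t" for t
    using \<phi> unfolding test_function_def by blast+
  then show "continuous_on S \<phi>" "continuous_on S (deriv \<phi>)"
    unfolding funpow.simps comp_def id_def
    by (intro continuous_at_imp_continuous_on ballI differentiable_imp_continuous_within; blast)+
qed

lemma test_function_eq_0:
  assumes "t \<notin> {0<..<T}"
  shows "\<phi> t = 0"
proof -
  have "{x. \<phi> x \<noteq> 0} \<subseteq> {0<..<T}"
    using \<phi> order_trans[OF closure_subset] unfolding test_function_def by blast
  then show ?thesis using assms by (metis (mono_tags) mem_Collect_eq subsetD)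
qed

text \<open>The fundamental theorem of calculus, with \<open>\<phi> 0 = 0\<close>. It brings test
  functions into the form required by \<open>integral_by_parts\<close>, which speaks of
  primitives.\<close>

lemma prim_deriv_test_function:
  assumes "t \<in> {0..T}"
  shows "prim T (deriv \<phi>) t = \<phi> t"
proof -
  have "prim T (deriv \<phi>) t = (LINT s|time_measure t. deriv \<phi> s)"
  proof -
    have "AE s in lebesgue. indicator {0<..<T} s *\<^sub>R indicator {..t} s *\<^sub>R deriv \<phi> s
        = indicator {0<..<t} s *\<^sub>R deriv \<phi> s"
      by (rule AE_I'[of "{t}"]) (use assms in \<open>auto simp: indicator_def split: if_splits\<close>)
    moreover have "deriv \<phi> \<in> borel_measurable borel"
      by (rule borel_measurable_continuous_onI) (rule test_function_continuous)
    ultimately show ?thesis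
      unfolding prim_def
      by (subst (1 2) integral_restrict_space)
        (auto intro!: integral_cong_AE measurable_completion borel_measurable_times borel_measurable_indicator)
  qed
  also have "\<dots> = integral {0..t} (deriv \<phi>)"
    by (rule integrable_continuous_time) (rule test_function_continuous)
  also have "\<dots> = \<phi> t - \<phi> 0"
    by (intro integral_unique fundamental_theorem_of_calculus)
      (use assms in \<open>auto simp: has_real_derivative_iff_has_vector_derivative[symmetric]
        intro: has_field_derivative_at_within test_function_has_derivative\<close>)
  finally show ?thesis by (simp add: test_function_eq_0)
qed

end

text \<open>By parts, \<open>prim T g\<close> has the weak derivative \<open>g\<close> as well: the
  product of total integrals drops out because \<open>deriv \<phi>\<close> integrates to
  \<open>\<phi> T = 0\<close>. Hence \<open>f - prim T g\<close> is orthogonal to all derivatives of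
  test functions.\<close>

lemma weak_derivative_imp_prim:
  fixes f g :: "real \<Rightarrow> 'a::{banach, second_countable_topology}"
  assumes f: "integrable (time_measure T) f" and g: "integrable (time_measure T) g" and "T > 0"
    and weak: "\<And>\<phi>. test_function T \<phi> \<Longrightarrow>
      (LINT t|time_measure T. deriv \<phi> t *\<^sub>R f t) = - (LINT t|time_measure T. \<phi> t *\<^sub>R g t)"
  shows "\<exists>c. AE t in time_measure T. f t = c + prim T g t"
proof -
  have ig: "integrable (time_measure T) (prim T g)"
    by (rule finite_measure.integrable_const_bound[OF finite_measure_time, where B = "LINT s|time_measure T. norm (g s)"])
      (intro AE_I2 norm_prim_le[OF g],
       intro borel_measurable_time borel_measurable_continuous_onI continuous_on_prim g)
  have "\<exists>c. AE t in time_measure T. f t - prim T g t = c"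
  proof (rule du_Bois_Reymond[OF _ \<open>T > 0\<close>])
    fix \<phi> assume \<phi>: "test_function T \<phi>"
    note cont = test_function_continuous[OF \<phi>, of UNIV]
    have "(LINT t|time_measure T. deriv \<phi> t) = prim T (deriv \<phi>) T"
      unfolding prim_def
      by (intro Bochner_Integration.integral_cong) (auto simp: space_restrict_space indicator_def)
    also have "\<dots> = 0"
      using prim_deriv_test_function[OF \<phi>, of T] test_function_eq_0[OF \<phi>, of T] \<open>T > 0\<close> by simp
    finally have "(LINT t|time_measure T. deriv \<phi> t *\<^sub>R prim T g t)
        = - (LINT t|time_measure T. prim T (deriv \<phi>) t *\<^sub>R g t)"
      using integral_by_parts[OF bounded_bilinear_scaleR integrable_continuous_time(1)[OF cont(2)] g]
      by (simp add: eq_neg_iff_add_eq_0)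
    also have "(LINT t|time_measure T. prim T (deriv \<phi>) t *\<^sub>R g t) = (LINT t|time_measure T. \<phi> t *\<^sub>R g t)"
      by (intro Bochner_Integration.integral_cong)
        (auto simp: space_restrict_space prim_deriv_test_function[OF \<phi>])
    finally show "(LINT t|time_measure T. deriv \<phi> t *\<^sub>R (f t - prim T g t)) = 0"
      using weak[OF \<phi>] integrable_scaleR_continuous[OF f cont(2)] integrable_scaleR_continuous[OF ig cont(2)]
      by (simp add: scaleR_diff_right Bochner_Integration.integral_diff)
  qed (use f ig in auto)
  then obtain c where "AE t in time_measure T. f t - prim T g t = c" by blast
  then have "AE t in time_measure T. f t = c + prim T g t"
    by (rule eventually_mono) (simp add: diff_eq_eq)
  then show ?thesis by blast
qed

subsection \<open>The pivot operator and its resolvent\<close>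

locale gelfand_form = coercive_form a
  for a :: "'v::{real_inner, banach, second_countable_topology} \<Rightarrow> 'v \<Rightarrow> real" +
  fixes \<iota> :: "'v \<Rightarrow> 'h::{real_inner, banach, second_countable_topology}"
  assumes gelfand: "gelfand_triple \<iota>"
begin

sublocale emb: bounded_linear \<iota>
  using gelfand by (simp add: gelfand_triple_def dense_embedding_def)

lemma pivot_apply: "blinfun_apply (pivot_embedding \<iota> h) w = h \<bullet> \<iota> w"
proof -
  have "bounded_linear (\<lambda>w. h \<bullet> \<iota> w)"
    by (rule bounded_linear_compose[OF bounded_linear_inner_right emb.bounded_linear_axioms])
  then show ?thesis by (simp add: pivot_embedding_def bounded_linear_Blinfun_apply)
qed

definition S :: "'v \<Rightarrow> 'v" where "S x = riesz_lift a (pivot_embedding \<iota> (\<iota> x))"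

lemma form_S: "a (S x) w = \<iota> x \<bullet> \<iota> w"
  by (simp add: S_def pivot_apply)

sublocale S: bounded_linear S
proof -
  have "bounded_linear (pivot_embedding \<iota>)"
    using gelfand by (simp add: gelfand_triple_def dense_embedding_def)
  from bounded_linear_compose[OF this emb.bounded_linear_axioms]
  show "bounded_linear S"
    unfolding S_def[abs_def] by (rule bounded_linear_compose[OF bounded_linear_riesz_lift])
qed

text \<open>Both densities of the triple enter: that of V in H puts the lift of H into the closure
  of the range, and that of H in the dual then puts the whole lifted dual, which is V,
  there.\<close>

lemma dense_range_S: "closure (range S) = UNIV"
proof -
  let ?j = "pivot_embedding \<iota>" and ?R = "riesz_lift a"
  have j: "bounded_linear ?j" "closure (range ?j) = UNIV" and i: "closure (range \<iota>) = UNIV"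
    using gelfand by (simp_all add: gelfand_triple_def dense_embedding_def)
  have "(\<lambda>h. ?R (?j h)) ` closure (range \<iota>) \<subseteq> closure (range S)"
    by (rule image_closure_subset[OF linear_continuous_on[OF bounded_linear_compose[OF bounded_linear_riesz_lift j(1)]]])
      (auto simp: S_def[symmetric] intro: closure_subset[THEN subsetD])
  then have 1: "range (\<lambda>h. ?R (?j h)) \<subseteq> closure (range S)" by (simp add: i)
  have "?R ` closure (range ?j) \<subseteq> closure (range S)"
    by (rule image_closure_subset[OF linear_continuous_on[OF bounded_linear_riesz_lift]])
      (use 1 in auto)
  moreover have "range ?R = UNIV" by (metis riesz_lift_iso surjI)
  ultimately show ?thesis by (simp add: j(2) top.extremum_unique)
qed

text \<open>This is \<open>a (\<epsilon> *\<^sub>R x + S x) y\<close>. Solving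
  \<open>\<epsilon> + S\<close> for a right-hand side is therefore a Riesz representation with
  respect to this form.\<close>

definition form_eps :: "real \<Rightarrow> 'v \<Rightarrow> 'v \<Rightarrow> real" where
  "form_eps \<epsilon> x y = \<epsilon> * a x y + \<iota> x \<bullet> \<iota> y"

lemma coercive_form_eps:
  assumes "\<epsilon> > 0"
  shows "coercive_form (form_eps \<epsilon>)"
proof (rule coercive_form.intro)
  obtain K where K: "\<And>x y. \<bar>a x y\<bar> \<le> norm x * norm y * K" "K > 0"
    using form.pos_bounded by auto
  obtain I where I: "\<And>x. norm (\<iota> x) \<le> norm x * I" "I > 0"
    using emb.pos_bounded by auto
  have "norm (form_eps \<epsilon> x y) \<le> norm x * norm y * (\<epsilon> * K + I * I)" for x y
  proof -
    have "\<bar>\<iota> x \<bullet> \<iota> y\<bar> \<le> norm (\<iota> x) * norm (\<iota> y)" by (rule Cauchy_Schwarz_ineq2)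
    also have "\<dots> \<le> (norm x * I) * (norm y * I)" using I by (intro mult_mono) auto
    finally have "\<bar>\<iota> x \<bullet> \<iota> y\<bar> \<le> norm x * norm y * (I * I)" by (simp add: ac_simps)
    moreover have "\<bar>\<epsilon> * a x y\<bar> \<le> norm x * norm y * (\<epsilon> * K)"
      using mult_left_mono[OF K(1)[of x y], of \<epsilon>] assms by (simp add: abs_mult ac_simps)
    ultimately show ?thesis by (simp add: form_eps_def distrib_left)
  qed
  then show "bounded_bilinear (form_eps \<epsilon>)"
    by (intro bounded_bilinear.intro exI[of _ "\<epsilon> * K + I * I"])
      (auto simp: form_eps_def form.add_left form.add_right form.scaleR_left form.scaleR_right
        emb.add emb.scaleR inner_add_left inner_add_right algebra_simps)
  show "form_eps \<epsilon> x y = form_eps \<epsilon> y x" for x y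
    by (simp add: form_eps_def sym[of x y] inner_commute)
  have "\<epsilon> * \<alpha> * (norm x)\<^sup>2 \<le> form_eps \<epsilon> x x" for x
    using mult_left_mono[OF \<alpha>_le[of x], of \<epsilon>] assms by (simp add: form_eps_def add_increasing2)
  then show "coercive_on UNIV norm (form_eps \<epsilon>)"
    unfolding coercive_on_def using \<alpha>_pos assms by (intro exI[of _ "\<epsilon> * \<alpha>"]) simp
qed

text \<open>The resolvent \<open>(\<epsilon> + S)\<^sup>-\<^sup>1\<close>, by which functions with values in \<open>V\<close> are regularised
  in the space variable instead of in time.\<close>

definition resolvent :: "real \<Rightarrow> 'v \<Rightarrow> 'v" where
  "resolvent \<epsilon> x = riesz_lift (form_eps \<epsilon>) (riesz_iso a x)"

context
  fixes \<epsilon> :: real assumes \<epsilon>: "\<epsilon> > 0"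
begin

interpretation eps: coercive_form "form_eps \<epsilon>" by (rule coercive_form_eps[OF \<epsilon>])

lemma bounded_linear_resolvent: "bounded_linear (resolvent \<epsilon>)"
  unfolding resolvent_def[abs_def]
  by (rule bounded_linear_compose[OF eps.bounded_linear_riesz_lift bounded_linear_riesz_iso])

lemma resolvent_eq: "\<epsilon> *\<^sub>R resolvent \<epsilon> x + S (resolvent \<epsilon> x) = x"
proof (rule form_eqI)
  fix w
  have "form_eps \<epsilon> (resolvent \<epsilon> x) w = a x w" by (simp add: resolvent_def)
  then show "a (\<epsilon> *\<^sub>R resolvent \<epsilon> x + S (resolvent \<epsilon> x)) w = a x w"
    by (simp add: form_eps_def form.add_left form.scaleR_left form_S)
qed

lemma resolvent_unique:
  assumes "\<epsilon> *\<^sub>R y + S y = x"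
  shows "resolvent \<epsilon> x = y"
proof (rule eps.form_eqI)
  fix w
  have "form_eps \<epsilon> (resolvent \<epsilon> x) w = a (\<epsilon> *\<^sub>R y + S y) w" by (simp add: resolvent_def assms)
  then show "form_eps \<epsilon> (resolvent \<epsilon> x) w = form_eps \<epsilon> y w"
    by (simp add: form_eps_def form.add_left form.scaleR_left form_S)
qed

lemma resolvent_S_commute: "resolvent \<epsilon> (S x) = S (resolvent \<epsilon> x)"
  by (rule resolvent_unique) (metis S.add S.scaleR resolvent_eq)

text \<open>Let \<open>r\<close> be the resolvent at \<open>x\<close>. Then \<open>x\<close> is the
  sum of \<open>S r\<close> and \<open>\<epsilon> *\<^sub>R r\<close>, and their mixed term is
  \<open>\<epsilon>\<close> times the squared H-norm of \<open>r\<close>, hence non-negative; so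
  neither part has more energy than \<open>x\<close>.\<close>

lemma form_S_resolvent_le: "a (S (resolvent \<epsilon> x)) (S (resolvent \<epsilon> x)) \<le> a x x"
  and form_diff_S_resolvent_le: "a (x - S (resolvent \<epsilon> x)) (x - S (resolvent \<epsilon> x)) \<le> a x x"
proof -
  let ?p = "S (resolvent \<epsilon> x)" and ?q = "\<epsilon> *\<^sub>R resolvent \<epsilon> x"
  have "a ?p ?q \<ge> 0" using \<epsilon> by (simp add: form.scaleR_right form_S)
  moreover have "?p + ?q = x" "x - ?p = ?q" using resolvent_eq[of x] by (simp_all add: algebra_simps)
  ultimately show "a ?p ?p \<le> a x x" "a (x - ?p) (x - ?p) \<le> a x x"
    using form_le_form_add[of ?p ?q] form_le_form_add[of ?q ?p] by (simp_all add: sym add.commute)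
qed

end

text \<open>The price for passing from energy to norm: a map that does not increase the energy has
  operator norm at most \<open>\<kappa>\<close>, uniformly in the regularisation parameter. The
  witness is the square root of the continuity constant over \<open>\<alpha>\<close>.\<close>

definition \<kappa> :: real where "\<kappa> = (SOME c. c > 0 \<and> (\<forall>x y. a y y \<le> a x x \<longrightarrow> norm y \<le> c * norm x))"

lemma \<kappa>_pos: "\<kappa> > 0" and norm_le_\<kappa>: "a y y \<le> a x x \<Longrightarrow> norm y \<le> \<kappa> * norm x"
proof -
  obtain K where K: "\<And>x y. \<bar>a x y\<bar> \<le> norm x * norm y * K" "K > 0"
    using form.pos_bounded by auto
  have "norm y \<le> sqrt (K / \<alpha>) * norm x" if "a y y \<le> a x x" for x y
  proof -
    have "\<alpha> * (norm y)\<^sup>2 \<le> (norm x)\<^sup>2 * K"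
      using that \<alpha>_le[of y] K(1)[of x x] by (simp add: power2_eq_square)
    then have "(norm y)\<^sup>2 \<le> (sqrt (K / \<alpha>) * norm x)\<^sup>2"
      using \<alpha>_pos K(2) by (simp add: power_mult_distrib field_simps)
    then show ?thesis by (rule power2_le_imp_le) (use \<alpha>_pos K(2) in simp)
  qed
  moreover have "sqrt (K / \<alpha>) > 0" using \<alpha>_pos K(2) by simp
  ultimately have "\<exists>c. c > 0 \<and> (\<forall>x y. a y y \<le> a x x \<longrightarrow> norm y \<le> c * norm x)" by blast
  from someI_ex[OF this] show "\<kappa> > 0" "a y y \<le> a x x \<Longrightarrow> norm y \<le> \<kappa> * norm x"
    unfolding \<kappa>_def by blast+
qed

definition res :: "nat \<Rightarrow> 'v \<Rightarrow> 'v" where "res n = resolvent (1 / real (Suc n))"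

lemma bounded_linear_res: "bounded_linear (res n)"
  by (simp add: res_def bounded_linear_resolvent)

lemma norm_S_res_le: "norm (S (res n x)) \<le> \<kappa> * norm x"
  and norm_diff_S_res_le: "norm (x - S (res n x)) \<le> \<kappa> * norm x"
  by (simp_all add: norm_le_\<kappa> res_def form_S_resolvent_le form_diff_S_resolvent_le)

lemma res_S: "res n (S x) = S (res n x)"
  by (simp add: res_def resolvent_S_commute)

text \<open>On a vector \<open>S z\<close> the error is \<open>S (res n z) / (n + 1)\<close>, hence
  of order 1/n. Such vectors are dense, and the error maps are uniformly bounded, so the convergence
  extends to all \<open>x\<close>.\<close>

lemma res_S_tendsto: "(\<lambda>n. res n (S x)) \<longlonglongrightarrow> x"
proof (rule LIMSEQ_I)
  fix e :: real assume "e > 0"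
  have "x \<in> closure (range S)" by (simp add: dense_range_S)
  then obtain z where z: "norm (x - S z) < e / (2 * \<kappa>)"
    using \<open>e > 0\<close> \<kappa>_pos unfolding closure_approachable
    by (metis dist_commute dist_norm divide_pos_pos imageE mult_pos_pos zero_less_numeral)
  \<comment> \<open>The added 1 keeps the denominator below positive when
    \<open>z = 0\<close>.\<close>
  have pos: "\<kappa> * norm z + 1 > 0" using \<kappa>_pos by (intro add_nonneg_pos mult_nonneg_nonneg) auto
  obtain N where N: "1 / real (Suc N) < e / (2 * (\<kappa> * norm z + 1))"
    using reals_Archimedean[of "e / (2 * (\<kappa> * norm z + 1))"] \<open>e > 0\<close> pos
    by (auto simp: inverse_eq_divide)
  show "\<exists>N. \<forall>n\<ge>N. norm (res n (S x) - x) < e"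
  proof (intro exI[of _ N] allI impI)
    fix n assume n: "N \<le> n"
    interpret L: bounded_linear "res n" by (rule bounded_linear_res)
    have "norm ((x - S z) - S (res n (x - S z))) \<le> \<kappa> * norm (x - S z)" by (rule norm_diff_S_res_le)
    also have "\<dots> < e / 2" using z \<kappa>_pos by (simp add: field_simps)
    finally have 1: "norm ((x - S z) - S (res n (x - S z))) < e / 2" .
    have "(1 / real (Suc n)) *\<^sub>R res n (S z) + S (res n (S z)) = S z"
      unfolding res_def by (rule resolvent_eq) simp
    then have "S z - S (res n (S z)) = (1 / real (Suc n)) *\<^sub>R S (res n z)"
      by (metis add_diff_cancel_right' res_S)
    then have "norm (S z - S (res n (S z))) = 1 / real (Suc n) * norm (S (res n z))"
      by simp
    also have "\<dots> \<le> 1 / real (Suc N) * (\<kappa> * norm z + 1)"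
    proof (rule mult_mono)
      show "norm (S (res n z)) \<le> \<kappa> * norm z + 1" using norm_S_res_le[of n z] by simp
    qed (use n in \<open>simp_all add: frac_le\<close>)
    also have "\<dots> < e / (2 * (\<kappa> * norm z + 1)) * (\<kappa> * norm z + 1)"
      by (rule mult_strict_right_mono[OF N pos])
    also have "\<dots> = e / 2"
    proof -
      have "e / (2 * m) * m = e / 2" if "m > 0" for m :: real using that by simp
      then show ?thesis using pos by blast
    qed
    finally have 2: "norm (S z - S (res n (S z))) < e / 2" .
    have split: "x - res n (S x) = ((x - S z) - S (res n (x - S z))) + (S z - S (res n (S z)))"
      by (simp add: res_S L.diff S.diff)
    have "norm (x - res n (S x)) < e"
      unfolding split by (rule norm_triangle_lt) (use 1 2 in linarith)
    then show "norm (res n (S x) - x) < e" by (simp only: norm_minus_commute)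
  qed
qed

end

section \<open>Energy identities for primitives\<close>

lemma quadratic_prim:
  fixes B :: "'a::{banach, second_countable_topology} \<Rightarrow> 'a \<Rightarrow> real"
  assumes B: "bounded_bilinear B" and sym: "\<And>x y. B x y = B y x"
    and G: "integrable (time_measure T) G"
  shows "B (c + prim T G t) (c + prim T G t) - B c c =
    2 * (LINT r|time_measure T. indicator {..t} r * B (G r) (c + prim T G r))"
proof -
  interpret B: bounded_bilinear B by (rule B)
  let ?M = "time_measure T"
  \<comment> \<open>\<open>G\<close> cut off after \<open>t\<close>: its full integral is
    \<open>prim T G t\<close>, and up to \<open>t\<close> it has the same primitive as
    \<open>G\<close>. Integration by parts over all of (0,T) thus gives the identity at time
    \<open>t\<close>.\<close>
  define f where "f r = indicat_real {..t} r *\<^sub>R G r" for r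
  have f: "integrable ?M f" unfolding f_def by (rule integrable_indicator_time[OF G]) simp
  have P: "prim T G t = (LINT r|?M. f r)" by (simp add: prim_def f_def)
  have pf: "prim T f r = prim T G r" if "r \<le> t" for r
    unfolding prim_def f_def
    by (intro Bochner_Integration.integral_cong) (use that in \<open>auto simp: indicator_def\<close>)
  have int1: "integrable ?M (\<lambda>r. B (f r) (prim T f r))"
    by (rule integrable_bilinear_bounded_right[OF B f])
      (intro borel_measurable_time borel_measurable_continuous_onI continuous_on_prim f,
        rule norm_prim_le[OF f])
  have int2: "integrable ?M (\<lambda>r. B (f r) c)"
    by (rule integrable_bounded_linear[OF B.bounded_linear_left f])
  have "B (prim T G t) (prim T G t) = 2 * (LINT r|?M. B (f r) (prim T f r))"
    using integral_by_parts[OF B f f] by (simp add: P sym)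
  moreover have "B (prim T G t) c = (LINT r|?M. B (f r) c)"
    by (simp add: P integral_bounded_linear[OF B.bounded_linear_left f])
  moreover have "B (c + prim T G t) (c + prim T G t) - B c c
      = 2 * B (prim T G t) c + B (prim T G t) (prim T G t)"
    by (simp add: B.add_left B.add_right sym[of c "prim T G t"])
  ultimately have "B (c + prim T G t) (c + prim T G t) - B c c
      = 2 * (LINT r|?M. B (f r) c + B (f r) (prim T f r))"
    using int1 int2 by simp
  also have "(\<lambda>r. B (f r) c + B (f r) (prim T f r))
      = (\<lambda>r. indicator {..t} r * B (G r) (c + prim T G r))"
  proof
    show "B (f r) c + B (f r) (prim T f r) = indicator {..t} r * B (G r) (c + prim T G r)" for r
      by (cases "r \<le> t") (auto simp: pf B.add_right B.scaleR_left f_def[of r] B.zero_left)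
  qed
  finally show ?thesis .
qed

text \<open>The values of \<open>B (U t) (U t)\<close> at any two times lie within
  \<open>2 * E\<close> of \<open>B c c\<close>, hence within \<open>4 * E\<close> of each other.
  Integrating over the second time eliminates the uncontrolled \<open>c\<close>.\<close>

lemma quadratic_prim_bound:
  fixes B :: "'a::{banach, second_countable_topology} \<Rightarrow> 'a \<Rightarrow> real"
  assumes B: "bounded_bilinear B" and sym: "\<And>x y. B x y = B y x"
    and G: "integrable (time_measure T) G" and U: "\<And>t. U t = c + prim T G t" and "T > 0"
  shows "T * B (U t) (U t) \<le> (LINT s|time_measure T. B (U s) (U s))
    + 4 * T * (LINT s|time_measure T. \<bar>B (G s) (U s)\<bar>)"
proof -
  interpret B: bounded_bilinear B by (rule B)
  let ?M = "time_measure T"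
  interpret finite_measure ?M by (rule finite_measure_time)
  define E where "E = (LINT s|?M. \<bar>B (G s) (U s)\<bar>)"
  have cU: "continuous_on UNIV U"
    unfolding U by (intro continuous_intros continuous_on_prim G)
  have bU: "norm (U s) \<le> norm c + (LINT s|?M. norm (G s))" for s
    unfolding U by (rule order_trans[OF norm_triangle_ineq]) (simp add: norm_prim_le[OF G])
  have iGU: "integrable ?M (\<lambda>s. B (G s) (U s))"
    by (rule integrable_bilinear_bounded_right[OF B G])
      (intro borel_measurable_time borel_measurable_continuous_onI cU, rule bU)
  have le: "\<bar>B (U t) (U t) - B c c\<bar> \<le> 2 * E" for t
  proof -
    have "\<bar>LINT r|?M. indicator {..t} r * B (G r) (U r)\<bar> \<le> (LINT r|?M. \<bar>indicator {..t} r * B (G r) (U r)\<bar>)"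
      using integral_norm_bound[of ?M "\<lambda>r. indicator {..t} r * B (G r) (U r)"] by simp
    also have "\<dots> \<le> E"
      unfolding E_def
    proof (rule integral_mono)
      show "integrable ?M (\<lambda>r. \<bar>indicat_real {..t} r * B (G r) (U r)\<bar>)"
        using integrable_abs[OF integrable_indicator_time[OF iGU, of "{..t}"]] by simp
    qed (use iGU in \<open>auto simp: indicator_def\<close>)
    finally show ?thesis using quadratic_prim[OF B sym G, of c t] by (simp add: U)
  qed
  have iUU: "integrable ?M (\<lambda>s. B (U s) (U s))"
    by (rule integrable_continuous_time(1)) (intro B.continuous_on cU)
  have "T * B (U t) (U t) = (LINT s|?M. B (U t) (U t))"
    using \<open>T > 0\<close> by (simp add: measure_restrict_space)
  also have "\<dots> \<le> (LINT s|?M. B (U s) (U s) + 4 * E)"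
  proof (rule integral_mono)
    show "B (U t) (U t) \<le> B (U s) (U s) + 4 * E" for s
      using le[of t] le[of s] by (simp add: abs_le_iff)
  qed (use iUU in auto)
  also have "\<dots> = (LINT s|?M. B (U s) (U s)) + 4 * T * E"
    using iUU \<open>T > 0\<close> by (simp add: measure_restrict_space)
  finally show ?thesis by (simp add: E_def)
qed

subsection \<open>Continuous representatives\<close>

text \<open>No countability is asked of the value space, because the facts on
  \<open>L2_space\<close> built on this also serve functions with values in the dual of V.\<close>

lemma borel_measurable_norm':
  fixes f :: "'b \<Rightarrow> 'a::real_normed_vector"
  assumes "f \<in> borel_measurable M"
  shows "(\<lambda>x. norm (f x)) \<in> borel_measurable M"
  by (rule measurable_compose[OF assms borel_measurable_continuous_onI[OF continuous_on_norm_id]])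

lemma L2_space_measurable: "f \<in> L2_space T \<Longrightarrow> f \<in> borel_measurable (time_measure T)"
  and L2_space_integrable_sq: "f \<in> L2_space T \<Longrightarrow> integrable (time_measure T) (\<lambda>t. (norm (f t))\<^sup>2)"
  by (simp_all add: L2_space_def)

lemma L2_space_integrable_norm_mult:
  assumes "f \<in> L2_space T" "g \<in> L2_space T"
  shows "integrable (time_measure T) (\<lambda>t. norm (f t) * norm (g t))"
proof (rule Bochner_Integration.integrable_bound)
  show "integrable (time_measure T) (\<lambda>t. (norm (f t))\<^sup>2 + (norm (g t))\<^sup>2)"
    using assms by (intro Bochner_Integration.integrable_add L2_space_integrable_sq)
  show "(\<lambda>t. norm (f t) * norm (g t)) \<in> borel_measurable (time_measure T)"
    by (intro borel_measurable_times borel_measurable_norm' L2_space_measurable assms)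
  have "x * y \<le> x\<^sup>2 + y\<^sup>2" if "0 \<le> x" "0 \<le> y" for x y :: real
    using sum_squares_bound[of x y] mult_nonneg_nonneg[OF that] by simp
  then show "AE t in time_measure T. norm (norm (f t) * norm (g t)) \<le> norm ((norm (f t))\<^sup>2 + (norm (g t))\<^sup>2)"
    by simp
qed

lemma L2_space_integrable:
  fixes f :: "real \<Rightarrow> 'a::{banach, second_countable_topology}"
  assumes "f \<in> L2_space T"
  shows "integrable (time_measure T) f"
proof -
  interpret finite_measure "time_measure T" by (rule finite_measure_time)
  have "(\<lambda>t. 1 :: real) \<in> L2_space T" by (simp add: L2_space_def)
  from L2_space_integrable_norm_mult[OF assms this]
  have "integrable (time_measure T) (\<lambda>t. norm (f t))" by simp
  then show ?thesis
    using integrable_norm_cancel L2_space_measurable[OF assms] by blast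
qed

lemma L2_space_bounded_linear:
  assumes L: "bounded_linear L" and f: "f \<in> L2_space T"
  shows "(\<lambda>t. L (f t)) \<in> L2_space T"
proof -
  have m: "(\<lambda>t. L (f t)) \<in> borel_measurable (time_measure T)"
    by (rule measurable_compose[OF L2_space_measurable[OF f] borel_measurable_continuous_onI])
      (rule linear_continuous_on[OF L])
  obtain K where K: "\<And>x. norm (L x) \<le> norm x * K" "K > 0"
    using bounded_linear.pos_bounded[OF L] by auto
  have "integrable (time_measure T) (\<lambda>t. (norm (L (f t)))\<^sup>2)"
  proof (rule Bochner_Integration.integrable_bound)
    show "integrable (time_measure T) (\<lambda>t. (norm (f t))\<^sup>2 * K\<^sup>2)"
      using L2_space_integrable_sq[OF f] by simp
    show "AE t in time_measure T. norm ((norm (L (f t)))\<^sup>2) \<le> norm ((norm (f t))\<^sup>2 * K\<^sup>2)"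
      using power_mono[OF K(1) norm_ge_zero, of _ 2] by (simp add: power_mult_distrib)
  qed (use m in \<open>intro borel_measurable_power borel_measurable_norm'\<close>)
  with m show ?thesis by (simp add: L2_space_def)
qed

lemma L2_space_add:
  fixes f g :: "real \<Rightarrow> 'a::{banach, second_countable_topology}"
  assumes f: "f \<in> L2_space T" and g: "g \<in> L2_space T"
  shows "(\<lambda>t. f t + g t) \<in> L2_space T"
proof -
  have m: "(\<lambda>t. f t + g t) \<in> borel_measurable (time_measure T)"
    by (intro borel_measurable_add L2_space_measurable f g)
  have "integrable (time_measure T) (\<lambda>t. (norm (f t + g t))\<^sup>2)"
  proof (rule Bochner_Integration.integrable_bound)
    show "integrable (time_measure T) (\<lambda>t. 2 * ((norm (f t))\<^sup>2 + (norm (g t))\<^sup>2))"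
      using f g by (intro integrable_mult_right Bochner_Integration.integrable_add L2_space_integrable_sq)
    have "(norm (x + y))\<^sup>2 \<le> 2 * ((norm x)\<^sup>2 + (norm y)\<^sup>2)" for x y :: 'a
    proof -
      have "(norm (x + y))\<^sup>2 \<le> (norm x + norm y)\<^sup>2"
        by (rule power_mono[OF norm_triangle_ineq]) simp
      also have "\<dots> \<le> 2 * ((norm x)\<^sup>2 + (norm y)\<^sup>2)"
        using sum_squares_bound[of "norm x" "norm y"] by (simp add: power2_sum)
      finally show ?thesis .
    qed
    then show "AE t in time_measure T. norm ((norm (f t + g t))\<^sup>2) \<le> norm (2 * ((norm (f t))\<^sup>2 + (norm (g t))\<^sup>2))"
      by simp
  qed (use m in \<open>intro borel_measurable_power borel_measurable_norm'\<close>)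
  with m show ?thesis by (simp add: L2_space_def)
qed

lemma L2_space_continuous:
  fixes f :: "real \<Rightarrow> 'a::real_normed_vector"
  assumes "continuous_on UNIV f"
  shows "f \<in> L2_space T"
  unfolding L2_space_def
  by (intro CollectI conjI borel_measurable_time borel_measurable_continuous_onI assms
      integrable_continuous_time(1) continuous_intros)

context gelfand_form
begin

text \<open>The common core of two estimates: \<open>L\<close> is one resolvent when the
  approximations are bounded, and a difference of two when they are shown to be Cauchy. The bound
  involves \<open>S\<close> composed with \<open>L\<close>, never the norm of \<open>L\<close>,
  which need not stay bounded along the approximation; \<open>\<omega>\<close> carries the
  information on \<open>L (U s)\<close> available for almost every \<open>s\<close>.\<close>

lemma emb_prim_bound:
  assumes G: "G \<in> L2_space T" and U: "\<And>t. U t = c + prim T G t" and "T > 0"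
    and L: "bounded_linear L" and C: "\<And>x. norm (S (L x)) \<le> C * norm x" "C \<ge> 0"
    and I: "\<And>x. norm (\<iota> x) \<le> norm x * I"
    and A: "\<And>x y. \<bar>a x y\<bar> \<le> norm x * norm y * A" "A \<ge> 0"
    and \<omega>: "\<omega> \<in> L2_space T" "AE s in time_measure T. norm (L (U s)) \<le> \<omega> s"
  shows "T * (norm (\<iota> (L (U t))))\<^sup>2 \<le>
    I\<^sup>2 * (LINT s|time_measure T. (\<omega> s)\<^sup>2) + 4 * T * A * C * (LINT s|time_measure T. norm (G s) * \<bar>\<omega> s\<bar>)"
proof -
  let ?M = "time_measure T"
  define B where "B x y = \<iota> (L x) \<bullet> \<iota> (L y)" for x y
  have iL: "bounded_linear (\<lambda>x. \<iota> (L x))"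
    by (rule bounded_linear_compose[OF emb.bounded_linear_axioms L])
  have B: "bounded_bilinear B"
    unfolding B_def[abs_def] by (rule bounded_bilinear.comp[OF bounded_bilinear_inner iL iL])
  have Bsym: "B x y = B y x" for x y by (simp add: B_def inner_commute)
  have cU: "continuous_on UNIV U"
    unfolding U by (intro continuous_intros continuous_on_prim L2_space_integrable G)
  have LU: "(\<lambda>s. L (U s)) \<in> L2_space T" and iLU: "(\<lambda>s. \<iota> (L (U s))) \<in> L2_space T"
    using L2_space_bounded_linear[OF L L2_space_continuous[OF cU]]
      L2_space_bounded_linear[OF iL L2_space_continuous[OF cU]] by auto
  have "(LINT s|?M. B (U s) (U s)) = (LINT s|?M. (norm (\<iota> (L (U s))))\<^sup>2)"
    by (simp add: B_def power2_norm_eq_inner)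
  also have "\<dots> \<le> (LINT s|?M. I\<^sup>2 * (\<omega> s)\<^sup>2)"
  proof (rule integral_mono_AE[OF L2_space_integrable_sq[OF iLU]])
    show "integrable ?M (\<lambda>s. I\<^sup>2 * (\<omega> s)\<^sup>2)" using L2_space_integrable_sq[OF \<omega>(1)] by simp
    show "AE s in ?M. (norm (\<iota> (L (U s))))\<^sup>2 \<le> I\<^sup>2 * (\<omega> s)\<^sup>2"
      using \<omega>(2)
    proof eventually_elim
      case (elim s)
      have "(norm (\<iota> (L (U s))))\<^sup>2 \<le> (norm (L (U s)) * I)\<^sup>2" by (rule power_mono[OF I]) simp
      also have "\<dots> = I\<^sup>2 * (norm (L (U s)))\<^sup>2" by (simp add: power_mult_distrib)
      also have "\<dots> \<le> I\<^sup>2 * (\<omega> s)\<^sup>2" by (intro mult_left_mono power_mono elim) auto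
      finally show ?case .
    qed
  qed
  finally have 1: "(LINT s|?M. B (U s) (U s)) \<le> I\<^sup>2 * (LINT s|?M. (\<omega> s)\<^sup>2)" by simp
  have int\<omega>: "integrable ?M (\<lambda>s. norm (G s) * \<bar>\<omega> s\<bar>)"
    using L2_space_integrable_norm_mult[OF G \<omega>(1)] by simp
  have "(LINT s|?M. \<bar>B (G s) (U s)\<bar>) \<le> (LINT s|?M. A * C * (norm (G s) * \<bar>\<omega> s\<bar>))"
  proof (rule integral_mono_AE')
    show "integrable ?M (\<lambda>s. A * C * (norm (G s) * \<bar>\<omega> s\<bar>))" using int\<omega> by simp
    show "AE s in ?M. \<bar>B (G s) (U s)\<bar> \<le> A * C * (norm (G s) * \<bar>\<omega> s\<bar>)"
      using \<omega>(2)
    proof eventually_elim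
      case (elim s)
      \<comment> \<open>The decisive rewriting: the inner product of H becomes the form, with
        \<open>S\<close> in front of \<open>L (G s)\<close>.\<close>
      have "\<bar>B (G s) (U s)\<bar> = \<bar>a (S (L (G s))) (L (U s))\<bar>" by (simp add: B_def form_S)
      also have "\<dots> \<le> norm (S (L (G s))) * norm (L (U s)) * A" by (rule A)
      also have "\<dots> \<le> (C * norm (G s)) * \<bar>\<omega> s\<bar> * A"
        using elim A(2) C by (intro mult_right_mono mult_mono) auto
      finally show ?case by (simp add: ac_simps)
    qed
  qed (use A(2) C(2) in auto)
  then have "(LINT s|?M. \<bar>B (G s) (U s)\<bar>) \<le> A * C * (LINT s|?M. norm (G s) * \<bar>\<omega> s\<bar>)" by simp
  from mult_left_mono[OF this, of "4 * T"]
  have 2: "4 * T * (LINT s|?M. \<bar>B (G s) (U s)\<bar>) \<le> 4 * T * A * C * (LINT s|?M. norm (G s) * \<bar>\<omega> s\<bar>)"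
    using \<open>T > 0\<close> by (simp add: mult.assoc)
  have "T * (norm (\<iota> (L (U t))))\<^sup>2 = T * B (U t) (U t)" by (simp add: B_def power2_norm_eq_inner)
  also have "\<dots> \<le> (LINT s|?M. B (U s) (U s)) + 4 * T * (LINT s|?M. \<bar>B (G s) (U s)\<bar>)"
    by (rule quadratic_prim_bound[OF B Bsym L2_space_integrable[OF G] U \<open>T > 0\<close>])
  finally show ?thesis using 1 2 by linarith
qed

text \<open>\<open>I\<close> and \<open>A\<close> are parameters, not obtained inside, so that the
  caller can fix them before \<open>v\<close> and arrive at one constant for all
  \<open>v\<close>.\<close>

lemma continuous_representative:
  assumes v: "v \<in> L2_space T" and G: "G \<in> L2_space T" and "T > 0"
    and ae: "AE t in time_measure T. S (v t) = c + prim T G t"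
    and I: "\<And>x. norm (\<iota> x) \<le> norm x * I"
    and A: "\<And>x y. \<bar>a x y\<bar> \<le> norm x * norm y * A" "A \<ge> 0"
  shows "\<exists>q. continuous_on UNIV q \<and> (AE t in time_measure T. q t = \<iota> (v t)) \<and>
    (\<forall>t. T * (norm (q t))\<^sup>2 \<le> \<kappa>\<^sup>2 * (I\<^sup>2 * (LINT s|time_measure T. (norm (v s))\<^sup>2)
      + 4 * T * A * (LINT s|time_measure T. norm (G s) * norm (v s))))"
proof -
  let ?M = "time_measure T"
  define U where "U t = c + prim T G t" for t
  define q where "q n t = \<iota> (res n (U t))" for n t
  \<comment> \<open>The regularisation error in V. It tends to 0 almost everywhere and is dominated
    by \<open>\<kappa>\<close> times the norm of \<open>v\<close>, hence its weighted integrals tend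
    to 0.\<close>
  define D where "D n t = norm (res n (U t) - v t)" for n t
  have cU: "continuous_on UNIV U"
    unfolding U_def by (intro continuous_intros continuous_on_prim L2_space_integrable G)
  have cq: "continuous_on UNIV (q n)" for n
    unfolding q_def
    by (intro bounded_linear.continuous_on[OF emb.bounded_linear_axioms]
        bounded_linear.continuous_on[OF bounded_linear_res] cU)
  have aeU: "AE t in ?M. U t = S (v t)" using ae by eventually_elim (simp add: U_def)
  have resU: "AE t in ?M. norm (res n (U t)) \<le> \<kappa> * norm (v t)" for n
    using aeU by eventually_elim (simp add: res_S norm_S_res_le)
  have D_le: "AE t in ?M. D n t \<le> \<kappa> * norm (v t)" for n
    using aeU by eventually_elim (simp add: D_def res_S norm_minus_commute norm_diff_S_res_le)
  have D_lim: "AE t in ?M. (\<lambda>n. D n t) \<longlonglongrightarrow> 0"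
    using aeU
  proof eventually_elim
    case (elim t)
    have "(\<lambda>n. norm (res n (S (v t)) - v t)) \<longlonglongrightarrow> norm (v t - v t)"
      by (intro tendsto_norm tendsto_diff res_S_tendsto tendsto_const)
    then show ?case by (simp add: D_def elim)
  qed
  have D0: "D n t \<ge> 0" for n t by (simp add: D_def)
  have DL2: "D n \<in> L2_space T" for n
  proof -
    have "(\<lambda>t. res n (U t) + - v t) \<in> L2_space T"
      by (intro L2_space_add L2_space_bounded_linear[OF bounded_linear_res L2_space_continuous[OF cU]]
          L2_space_bounded_linear[OF bounded_linear_minus[OF bounded_linear_ident] v])
    then show ?thesis by (simp add: L2_space_def D_def[abs_def] borel_measurable_norm')
  qed
  \<comment> \<open>The share of index \<open>n\<close> in the estimate for a difference of two
    resolvents. The first factor 2 comes from bounding the square of the sum of two errors, and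
    \<open>2 * \<kappa>\<close> bounds \<open>S\<close> composed with the difference.\<close>
  define \<delta> where "\<delta> n = 2 * I\<^sup>2 * (LINT s|?M. (D n s)\<^sup>2)
    + 4 * T * A * (2 * \<kappa>) * (LINT s|?M. norm (G s) * D n s)" for n
  have iG: "integrable ?M (\<lambda>s. norm (G s) * D n s)" for n
    using L2_space_integrable_norm_mult[OF G DL2[of n]] by (simp add: D_def)
  have iD: "integrable ?M (\<lambda>s. (D n s)\<^sup>2)" for n
    using L2_space_integrable_sq[OF DL2[of n]] by simp
  have lim1: "(\<lambda>n. LINT s|?M. (D n s)\<^sup>2) \<longlonglongrightarrow> (LINT s|?M. 0)"
  proof (rule integral_dominated_convergence[where w = "\<lambda>s. \<kappa>\<^sup>2 * (norm (v s))\<^sup>2"])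
    show "integrable ?M (\<lambda>s. \<kappa>\<^sup>2 * (norm (v s))\<^sup>2)" using L2_space_integrable_sq[OF v] by simp
    show "AE s in ?M. (\<lambda>n. (D n s)\<^sup>2) \<longlonglongrightarrow> 0"
      using D_lim
    proof eventually_elim
      case (elim s)
      from tendsto_power[OF this, of 2] show ?case by simp
    qed
    show "AE s in ?M. norm ((D n s)\<^sup>2) \<le> \<kappa>\<^sup>2 * (norm (v s))\<^sup>2" for n
      using D_le[of n]
    proof eventually_elim
      case (elim s)
      from power_mono[OF this D0, of 2] show ?case by (simp add: power_mult_distrib)
    qed
  qed (use iD in auto)
  have lim2: "(\<lambda>n. LINT s|?M. norm (G s) * D n s) \<longlonglongrightarrow> (LINT s|?M. 0)"
  proof (rule integral_dominated_convergence[where w = "\<lambda>s. \<kappa> * (norm (G s) * norm (v s))"])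
    show "integrable ?M (\<lambda>s. \<kappa> * (norm (G s) * norm (v s)))"
      using L2_space_integrable_norm_mult[OF G v] by simp
    show "AE s in ?M. (\<lambda>n. norm (G s) * D n s) \<longlonglongrightarrow> 0"
      using D_lim
    proof eventually_elim
      case (elim s)
      from tendsto_mult_left[OF this, of "norm (G s)"] show ?case by simp
    qed
    show "AE s in ?M. norm (norm (G s) * D n s) \<le> \<kappa> * (norm (G s) * norm (v s))" for n
      using D_le[of n]
    proof eventually_elim
      case (elim s)
      from mult_left_mono[OF this, of "norm (G s)"] show ?case by (simp add: abs_mult D0 ac_simps)
    qed
  qed (use iG in auto)
  have "\<delta> \<longlonglongrightarrow> 2 * I\<^sup>2 * (LINT s|?M. 0) + 4 * T * A * (2 * \<kappa>) * (LINT s|?M. 0)"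
    unfolding \<delta>_def by (intro tendsto_add tendsto_mult tendsto_const lim1 lim2)
  then have \<delta>: "\<delta> \<longlonglongrightarrow> 0" by simp
  have cauchy: "T * (norm (q n t - q m t))\<^sup>2 \<le> \<delta> n + \<delta> m" for n m t
  proof -
    let ?L = "\<lambda>x. res n x - res m x"
    have "T * (norm (\<iota> (?L (U t))))\<^sup>2 \<le> I\<^sup>2 * (LINT s|?M. (D n s + D m s)\<^sup>2)
        + 4 * T * A * (2 * \<kappa>) * (LINT s|?M. norm (G s) * \<bar>D n s + D m s\<bar>)"
    proof (rule emb_prim_bound[OF G U_def \<open>T > 0\<close> _ _ _ I A])
      show "bounded_linear ?L" by (intro bounded_linear_sub bounded_linear_res)
      show "norm (S (?L x)) \<le> 2 * \<kappa> * norm x" for x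
        using norm_triangle_ineq4[of "S (res n x)" "S (res m x)"] norm_S_res_le[of n x] norm_S_res_le[of m x]
        by (simp add: S.diff)
      show "(\<lambda>s. D n s + D m s) \<in> L2_space T" by (intro L2_space_add DL2)
      show "AE s in ?M. norm (?L (U s)) \<le> D n s + D m s"
      proof (rule AE_I2)
        show "norm (?L (U s)) \<le> D n s + D m s" for s
          using norm_triangle_ineq4[of "res n (U s) - v s" "res m (U s) - v s"] by (simp add: D_def)
      qed
    qed (use \<kappa>_pos in auto)
    also have "(LINT s|?M. norm (G s) * \<bar>D n s + D m s\<bar>)
        = (LINT s|?M. norm (G s) * D n s) + (LINT s|?M. norm (G s) * D m s)"
      using iG by (simp add: D0 distrib_left)
    also have "I\<^sup>2 * (LINT s|?M. (D n s + D m s)\<^sup>2) \<le> I\<^sup>2 * (LINT s|?M. 2 * (D n s)\<^sup>2 + 2 * (D m s)\<^sup>2)"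
    proof (intro mult_left_mono integral_mono_AE' AE_I2)
      show "(D n s + D m s)\<^sup>2 \<le> 2 * (D n s)\<^sup>2 + 2 * (D m s)\<^sup>2" for s
        using sum_squares_bound[of "D n s" "D m s"] by (simp add: power2_sum)
    qed (use iD in auto)
    also have "(LINT s|?M. 2 * (D n s)\<^sup>2 + 2 * (D m s)\<^sup>2)
        = 2 * (LINT s|?M. (D n s)\<^sup>2) + 2 * (LINT s|?M. (D m s)\<^sup>2)"
      using iD by simp
    finally show ?thesis by (simp add: q_def emb.diff \<delta>_def algebra_simps)
  qed
  have "uniformly_Cauchy_on UNIV q"
  proof (rule uniformly_Cauchy_onI)
    fix e :: real assume "e > 0"
    then have "T * e\<^sup>2 / 2 > 0" using \<open>T > 0\<close> by simp
    from order_tendstoD(2)[OF \<delta> this]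
    obtain N where N: "\<And>n. n \<ge> N \<Longrightarrow> \<delta> n < T * e\<^sup>2 / 2" unfolding eventually_sequentially by blast
    show "\<exists>N. \<forall>t\<in>UNIV. \<forall>m\<ge>N. \<forall>n\<ge>N. dist (q m t) (q n t) < e"
    proof (intro exI[of _ N] ballI allI impI)
      fix t m n assume "N \<le> m" "N \<le> n"
      have "T * (norm (q m t - q n t))\<^sup>2 < T * e\<^sup>2"
        using cauchy[of m t n] N[OF \<open>N \<le> m\<close>] N[OF \<open>N \<le> n\<close>] by linarith
      then have "(norm (q m t - q n t))\<^sup>2 < e\<^sup>2" using \<open>T > 0\<close> by simp
      then show "dist (q m t) (q n t) < e"
        unfolding dist_norm by (rule power2_less_imp_less) (use \<open>e > 0\<close> in simp)
    qed
  qed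
  from Cauchy_uniformly_convergent[OF this] obtain r where r: "uniform_limit UNIV q r sequentially"
    unfolding uniformly_convergent_on_def by blast
  have r_lim: "(\<lambda>n. q n t) \<longlonglongrightarrow> r t" for t by (rule tendsto_uniform_limitI[OF r]) simp
  show ?thesis
  proof (intro exI[of _ r] conjI allI)
    show "continuous_on UNIV r"
      by (rule uniform_limit_theorem[OF _ r]) (simp_all add: cq)
    show "AE t in ?M. r t = \<iota> (v t)"
      using aeU
    proof eventually_elim
      case (elim t)
      have "(\<lambda>n. q n t) \<longlonglongrightarrow> \<iota> (v t)"
        unfolding q_def elim by (intro emb.tendsto res_S_tendsto)
      then show ?case using r_lim LIMSEQ_unique by blast
    qed
    let ?R = "\<kappa>\<^sup>2 * (I\<^sup>2 * (LINT s|?M. (norm (v s))\<^sup>2) + 4 * T * A * (LINT s|?M. norm (G s) * norm (v s)))"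
    fix t
    \<comment> \<open>The core estimate again, for a single resolvent and with
      \<open>\<omega>\<close> equal to \<open>\<kappa>\<close> times the norm of \<open>v\<close>;
      the bound is free of \<open>n\<close> and survives the limit.\<close>
    have "T * (norm (q n t))\<^sup>2 \<le> ?R" for n
    proof -
      have "T * (norm (\<iota> (res n (U t))))\<^sup>2 \<le> I\<^sup>2 * (LINT s|?M. (\<kappa> * norm (v s))\<^sup>2)
        + 4 * T * A * \<kappa> * (LINT s|?M. norm (G s) * \<bar>\<kappa> * norm (v s)\<bar>)"
      proof (rule emb_prim_bound[OF G U_def \<open>T > 0\<close> bounded_linear_res norm_S_res_le _ I A _ resU])
        have "(\<lambda>s. norm (v s)) \<in> L2_space T" using v by (simp add: L2_space_def borel_measurable_norm')
        then show "(\<lambda>s. \<kappa> * norm (v s)) \<in> L2_space T"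
          by (rule L2_space_bounded_linear[OF bounded_linear_mult_right])
      qed (use \<kappa>_pos in auto)
      also have "(LINT s|?M. norm (G s) * \<bar>\<kappa> * norm (v s)\<bar>) = (LINT s|?M. \<kappa> * (norm (G s) * norm (v s)))"
        using \<kappa>_pos by (simp add: abs_mult ac_simps)
      finally show ?thesis
        by (simp add: q_def power_mult_distrib algebra_simps power2_eq_square)
    qed
    moreover have "(\<lambda>n. T * (norm (q n t))\<^sup>2) \<longlonglongrightarrow> T * (norm (r t))\<^sup>2"
      by (intro tendsto_intros r_lim)
    ultimately show "T * (norm (r t))\<^sup>2 \<le> ?R"
      by (intro LIMSEQ_le_const2) auto
  qed
qed

end

subsection \<open>The space \<open>W(0,T)\<close>\<close>

text \<open>Inside (0,T) the set of disagreement is open and null, hence empty; the endpoints follow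
  by closure.\<close>

lemma continuous_AE_eq_imp_eq:
  fixes f g :: "real \<Rightarrow> 'a::real_normed_vector"
  assumes f: "continuous_on {0..T} f" and g: "continuous_on {0..T} g"
    and ae: "AE t in time_measure T. f t = g t" and "T > 0" and t: "t \<in> {0..T}"
  shows "f t = g t"
proof -
  let ?N = "{0<..<T} \<inter> {s. f s - g s \<noteq> 0}"
  have "continuous_on {0<..<T} (\<lambda>s. f s - g s)"
    by (intro continuous_on_diff continuous_on_subset[OF f] continuous_on_subset[OF g]) auto
  then have "open ({0<..<T} \<inter> (\<lambda>s. f s - g s) -` (- {0}))"
    by (rule continuous_open_preimage) auto
  moreover have "{0<..<T} \<inter> (\<lambda>s. f s - g s) -` (- {0}) = ?N" by auto
  ultimately have "open ?N" by simp
  moreover have "negligible ?N"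
  proof -
    have "AE s in lebesgue. s \<notin> ?N"
      using ae by (auto simp: AE_restrict_space_iff elim: eventually_mono)
    then have "?N \<in> null_sets lebesgue"
      by (subst AE_iff_null_sets) (use \<open>open ?N\<close> in auto)
    then show ?thesis by (simp add: negligible_iff_null_sets)
  qed
  ultimately have "?N = {}" using open_not_negligible by blast
  then have "f s - g s = 0" if "s \<in> {0<..<T}" for s using that by blast
  then have "f t - g t = 0"
    by (intro continuous_constant_on_closure[of "{0<..<T}" "\<lambda>s. f s - g s" 0 t])
      (use f g t \<open>T > 0\<close> in \<open>auto intro: continuous_on_diff\<close>)
  then show ?thesis by simp
qed

text \<open>Resolves the definite description in \<open>point_value\<close>: \<open>q\<close>
  provides existence, and continuous representatives are unique. Later facts on point values are
  read off from a representative through this.\<close>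

lemma point_value_eq:
  assumes "continuous_on {0..T} q" "AE s in time_measure T. q s = \<iota> (v s)" "T > 0" "t \<in> {0..T}"
  shows "point_value T \<iota> v t = q t"
  unfolding point_value_def
proof (rule the_equality)
  show "\<exists>g. continuous_on {0..T} g \<and> ae_eq T g (\<lambda>s. \<iota> (v s)) \<and> g t = q t"
    using assms by (auto simp: ae_eq_def)
  fix h assume "\<exists>g. continuous_on {0..T} g \<and> ae_eq T g (\<lambda>s. \<iota> (v s)) \<and> g t = h"
  then obtain g where g: "continuous_on {0..T} g" "AE s in time_measure T. g s = \<iota> (v s)" "g t = h"
    by (auto simp: ae_eq_def)
  have "AE s in time_measure T. g s = q s"
    using g(2) assms(2) by eventually_elim simp
  from continuous_AE_eq_imp_eq[OF g(1) assms(1) this assms(3,4)] g(3) show "h = q t" by simp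
qed

lemma linear_form_on_add:
  "linear_form_on T W k \<Longrightarrow> linear_form_on T W l \<Longrightarrow> linear_form_on T W (\<lambda>v. k v + l v)"
  by (simp add: linear_form_on_def algebra_simps)

text \<open>The vectors form a set of functions with pointwise operations, not a type, so closure of
  \<open>W\<close> is assumed explicitly. The proof is the discriminant of \<open>b\<close> along
  the line \<open>u + s v\<close>.\<close>

lemma symmetric_form_Cauchy_Schwarz:
  assumes b: "bilinear_form_on T W b" and sym: "symmetric_on W b"
    and nonneg: "\<And>v. v \<in> W \<Longrightarrow> 0 \<le> b v v"
    and W: "\<And>u v. u \<in> W \<Longrightarrow> v \<in> W \<Longrightarrow> (\<lambda>t. u t + v t) \<in> W"
      "\<And>c v. v \<in> W \<Longrightarrow> (\<lambda>t. c *\<^sub>R v t) \<in> W"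
    and u: "u \<in> W" and v: "v \<in> W"
  shows "(b u v)\<^sup>2 \<le> b u u * b v v"
proof (rule quadratic_nonneg_imp_discriminant)
  fix s :: real
  define w where "w = (\<lambda>t. s *\<^sub>R v t)"
  have w: "w \<in> W" using W(2)[OF v] by (simp add: w_def)
  have left: "linear_form_on T W (\<lambda>v. b v z)" and right: "linear_form_on T W (b z)" if "z \<in> W" for z
    using b that by (auto simp: bilinear_form_on_def)
  have add_left: "b (\<lambda>t. x t + y t) z = b x z + b y z" and add_right: "b z (\<lambda>t. x t + y t) = b z x + b z y"
    and scale_left: "b (\<lambda>t. c *\<^sub>R x t) z = c * b x z" and scale_right: "b z (\<lambda>t. c *\<^sub>R x t) = c * b z x"
    if "x \<in> W" "y \<in> W" "z \<in> W" for x y z c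
    using left[OF that(3)] right[OF that(3)] that unfolding linear_form_on_def by blast+
  have "b (\<lambda>t. u t + w t) (\<lambda>t. u t + w t) = b u u + b u w + (b w u + b w w)"
    by (simp add: add_left add_right W(1) u w)
  moreover have "b u w = s * b u v" "b w u = s * b u v" "b w w = s * (s * b v v)"
    using scale_left[OF v v u] scale_right[OF v v u] scale_left[OF v v w] scale_right[OF v v v] sym u v
    by (simp_all add: w_def symmetric_on_def)
  ultimately show "0 \<le> b u u + 2 * s * b u v + s\<^sup>2 * b v v"
    using nonneg[OF W(1)[OF u w]] by (simp add: power2_eq_square)
qed

context gelfand_form
begin

lemma integrable_form:
  assumes "F \<in> L2_space T" "G \<in> L2_space T"
  shows "integrable (time_measure T) (\<lambda>t. a (F t) (G t))"
proof -
  obtain K where K: "\<And>x y. \<bar>a x y\<bar> \<le> norm x * norm y * K" "K > 0"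
    using form.pos_bounded by auto
  show ?thesis
  proof (rule Bochner_Integration.integrable_bound)
    show "integrable (time_measure T) (\<lambda>t. norm (F t) * norm (G t) * K)"
      using L2_space_integrable_norm_mult[OF assms] by simp
    show "(\<lambda>t. a (F t) (G t)) \<in> borel_measurable (time_measure T)"
      by (intro borel_measurable_bilinear[OF bilinear] L2_space_measurable assms)
  qed (use K in \<open>auto simp: abs_mult\<close>)
qed

lemma integral_form_Cauchy_Schwarz:
  assumes F: "F \<in> L2_space T" and G: "G \<in> L2_space T"
  shows "\<bar>LINT t|time_measure T. a (F t) (G t)\<bar> \<le>
    sqrt (LINT t|time_measure T. a (F t) (F t)) * sqrt (LINT t|time_measure T. a (G t) (G t))"
proof -
  let ?I = "\<lambda>F G. LINT t|time_measure T. a (F t) (G t)"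
  have "(?I F G)\<^sup>2 \<le> ?I F F * ?I G G"
  proof (rule quadratic_nonneg_imp_discriminant)
    fix s :: real
    have "0 \<le> (LINT t|time_measure T. a (F t + s *\<^sub>R G t) (F t + s *\<^sub>R G t))"
      by (simp add: form_nonneg)
    also have "\<dots> = (LINT t|time_measure T. a (F t) (F t) + 2 * s * a (F t) (G t) + s\<^sup>2 * a (G t) (G t))"
      by (simp add: form_add_self form.scaleR_left form.scaleR_right power2_eq_square ac_simps)
    also have "\<dots> = ?I F F + 2 * s * ?I F G + s\<^sup>2 * ?I G G"
      using integrable_form[OF F F] integrable_form[OF F G] integrable_form[OF G G] by simp
    finally show "0 \<le> ?I F F + 2 * s * ?I F G + s\<^sup>2 * ?I G G" .
  qed
  then have "sqrt ((?I F G)\<^sup>2) \<le> sqrt (?I F F * ?I G G)" by (rule real_sqrt_le_mono)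
  then show ?thesis by (simp add: real_sqrt_mult)
qed

text \<open>Weak derivatives transported to \<open>V\<close> by the Riesz lift, where the Bochner integral exists.\<close>

lemma L2_space_riesz_lift_iff: "(\<lambda>t. riesz_lift a (g t)) \<in> L2_space T \<longleftrightarrow> g \<in> L2_space T"
  using L2_space_bounded_linear[OF bounded_linear_riesz_lift, of g]
    L2_space_bounded_linear[OF bounded_linear_riesz_iso, of "\<lambda>t. riesz_lift a (g t)"] by auto

definition lifted_deriv :: "real \<Rightarrow> (real \<Rightarrow> 'v) \<Rightarrow> (real \<Rightarrow> 'v) \<Rightarrow> bool" where
  "lifted_deriv T v G \<longleftrightarrow> v \<in> L2_space T \<and> G \<in> L2_space T \<and>
    (\<forall>\<phi>. test_function T \<phi> \<longrightarrow>
      (LINT t|time_measure T. deriv \<phi> t *\<^sub>R S (v t)) = - (LINT t|time_measure T. \<phi> t *\<^sub>R G t))"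

text \<open>The maps \<open>a _ w\<close> commute with the Bochner integral and together separate
  the points of V, so one identity in V is equivalent to the family of scalar identities over all
  \<open>w\<close>.\<close>

lemma lifted_deriv_iff:
  assumes v: "v \<in> L2_space T" and g: "g \<in> L2_space T"
  shows "has_weak_deriv T \<iota> v g \<longleftrightarrow> lifted_deriv T v (\<lambda>t. riesz_lift a (g t))"
proof -
  let ?M = "time_measure T" and ?G = "\<lambda>t. riesz_lift a (g t)"
  have G: "?G \<in> L2_space T" using g by (simp add: L2_space_riesz_lift_iff)
  have Sv: "(\<lambda>t. S (v t)) \<in> L2_space T" by (rule L2_space_bounded_linear[OF S.bounded_linear_axioms v])
  have "((LINT t|?M. deriv \<phi> t *\<^sub>R S (v t)) = - (LINT t|?M. \<phi> t *\<^sub>R ?G t)) \<longleftrightarrow>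
    (\<forall>w. (LINT t|?M. deriv \<phi> t * blinfun_apply (pivot_embedding \<iota> (\<iota> (v t))) w) =
        - (LINT t|?M. \<phi> t * blinfun_apply (g t) w))" if \<phi>: "test_function T \<phi>" for \<phi>
  proof -
    note cont = test_function_continuous[OF \<phi>, of UNIV]
    have i1: "integrable ?M (\<lambda>t. deriv \<phi> t *\<^sub>R S (v t))"
      by (rule integrable_scaleR_continuous[OF L2_space_integrable[OF Sv] cont(2)])
    have i2: "integrable ?M (\<lambda>t. \<phi> t *\<^sub>R ?G t)"
      by (rule integrable_scaleR_continuous[OF L2_space_integrable[OF G] cont(1)])
    have e1: "a (LINT t|?M. deriv \<phi> t *\<^sub>R S (v t)) w =
        (LINT t|?M. deriv \<phi> t * blinfun_apply (pivot_embedding \<iota> (\<iota> (v t))) w)" for w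
      by (subst integral_bounded_linear[OF form.bounded_linear_left i1, symmetric])
        (simp add: form.scaleR_left form_S pivot_apply)
    have e2: "a (- (LINT t|?M. \<phi> t *\<^sub>R ?G t)) w = - (LINT t|?M. \<phi> t * blinfun_apply (g t) w)" for w
      unfolding form.minus_left
      by (subst integral_bounded_linear[OF form.bounded_linear_left i2, symmetric])
        (simp add: form.scaleR_left)
    show ?thesis unfolding e1[symmetric] e2[symmetric] using form_eqI by auto
  qed
  then show ?thesis
    using v G by (auto simp: has_weak_deriv_def lifted_deriv_def)
qed

lemma W_space_iff: "v \<in> W_space T \<iota> \<longleftrightarrow> (\<exists>G. lifted_deriv T v G)"
proof
  assume "v \<in> W_space T \<iota>"
  then show "\<exists>G. lifted_deriv T v G" using lifted_deriv_iff by (auto simp: W_space_def)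
next
  assume "\<exists>G. lifted_deriv T v G"
  then obtain G where G: "lifted_deriv T v G" by blast
  then have "v \<in> L2_space T" "(\<lambda>t. riesz_iso a (G t)) \<in> L2_space T"
    using L2_space_bounded_linear[OF bounded_linear_riesz_iso] by (auto simp: lifted_deriv_def)
  with G show "v \<in> W_space T \<iota>"
    using lifted_deriv_iff[of v T "\<lambda>t. riesz_iso a (G t)"] by (auto simp: W_space_def)
qed

definition lift_wd :: "real \<Rightarrow> (real \<Rightarrow> 'v) \<Rightarrow> real \<Rightarrow> 'v" where
  "lift_wd T v t = riesz_lift a (weak_deriv T \<iota> v t)"

lemma lifted_deriv_lift_wd: "v \<in> W_space T \<iota> \<Longrightarrow> lifted_deriv T v (lift_wd T v)"
proof -
  assume v: "v \<in> W_space T \<iota>"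
  then have "\<exists>g. g \<in> L2_space T \<and> has_weak_deriv T \<iota> v g" by (auto simp: W_space_def)
  from someI_ex[OF this] v show ?thesis
    using lifted_deriv_iff[of v T "weak_deriv T \<iota> v"]
    by (auto simp: W_space_def weak_deriv_def lift_wd_def[abs_def])
qed

lemma W_space_L2: "v \<in> W_space T \<iota> \<Longrightarrow> v \<in> L2_space T"
  and lift_wd_L2: "v \<in> W_space T \<iota> \<Longrightarrow> lift_wd T v \<in> L2_space T"
  using lifted_deriv_lift_wd[of v T] by (auto simp: lifted_deriv_def)

text \<open>Allowing \<open>u\<close> and \<open>v\<close> to differ on a null set gives two facts
  at once: the choice made in \<open>weak_deriv\<close> is immaterial, and the derivative respects
  equality almost everywhere.\<close>

lemma lifted_deriv_unique:
  assumes "T > 0" and F: "lifted_deriv T u F" and G: "lifted_deriv T v G"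
    and ae: "AE t in time_measure T. u t = v t"
  shows "AE t in time_measure T. F t = G t"
proof -
  let ?M = "time_measure T"
  have L2: "u \<in> L2_space T" "v \<in> L2_space T" "F \<in> L2_space T" "G \<in> L2_space T"
    using F G by (auto simp: lifted_deriv_def)
  have "AE t in ?M. F t - G t = 0"
  proof (rule AE_eq_0_if_bump_integrals_eq_0[OF _ \<open>T > 0\<close>])
    show "integrable ?M (\<lambda>t. F t - G t)" using L2 by (simp add: L2_space_integrable)
    fix n c d assume cd: "0 < c" "c < d" "d < T"
    let ?b = "bump n c d"
    have b: "test_function T ?b"
      by (rule flat_algebra_test_function[OF bump_in_flat_algebra, of c d]) (use cd in \<open>auto intro: bump_eq_0\<close>)
    have "(LINT t|?M. deriv ?b t *\<^sub>R S (u t)) = (LINT t|?M. deriv ?b t *\<^sub>R S (v t))"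
    proof (rule integral_cong_AE)
      show "AE t in ?M. deriv ?b t *\<^sub>R S (u t) = deriv ?b t *\<^sub>R S (v t)"
        using ae by eventually_elim simp
    qed (intro borel_measurable_integrable integrable_scaleR_continuous L2_space_integrable
        L2_space_bounded_linear[OF S.bounded_linear_axioms] L2 test_function_continuous[OF b])+
    then have "(LINT t|?M. ?b t *\<^sub>R F t) = (LINT t|?M. ?b t *\<^sub>R G t)"
      using F G b by (simp add: lifted_deriv_def)
    moreover have "integrable ?M (\<lambda>t. ?b t *\<^sub>R F t)" "integrable ?M (\<lambda>t. ?b t *\<^sub>R G t)"
      by (intro integrable_scaleR_continuous L2_space_integrable L2 test_function_continuous[OF b])+
    ultimately show "(LINT t|?M. ?b t *\<^sub>R (F t - G t)) = 0"
      by (simp add: scaleR_diff_right Bochner_Integration.integral_diff)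
  qed
  then show ?thesis by simp
qed

lemma lifted_deriv_add:
  assumes "lifted_deriv T u F" "lifted_deriv T v G"
  shows "lifted_deriv T (\<lambda>t. u t + v t) (\<lambda>t. F t + G t)"
proof -
  have L2: "u \<in> L2_space T" "v \<in> L2_space T" "F \<in> L2_space T" "G \<in> L2_space T"
    using assms by (auto simp: lifted_deriv_def)
  have int: "integrable (time_measure T) (\<lambda>t. \<phi> t *\<^sub>R f t)"
    if "continuous_on UNIV \<phi>" "f \<in> L2_space T" for \<phi> :: "real \<Rightarrow> real" and f :: "real \<Rightarrow> 'v"
    by (rule integrable_scaleR_continuous[OF L2_space_integrable[OF that(2)] that(1)])
  show ?thesis
    unfolding lifted_deriv_def
  proof (intro conjI allI impI)
    fix \<phi> assume \<phi>: "test_function T \<phi>"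
    note cont = test_function_continuous[OF \<phi>, of UNIV]
    have SL2: "(\<lambda>t. S (u t)) \<in> L2_space T" "(\<lambda>t. S (v t)) \<in> L2_space T"
      by (intro L2_space_bounded_linear[OF S.bounded_linear_axioms] L2)+
    have "(LINT t|time_measure T. deriv \<phi> t *\<^sub>R S (u t + v t))
        = (LINT t|time_measure T. deriv \<phi> t *\<^sub>R S (u t)) + (LINT t|time_measure T. deriv \<phi> t *\<^sub>R S (v t))"
      unfolding S.add scaleR_add_right
      by (intro Bochner_Integration.integral_add int cont SL2)
    moreover have "(LINT t|time_measure T. \<phi> t *\<^sub>R (F t + G t))
        = (LINT t|time_measure T. \<phi> t *\<^sub>R F t) + (LINT t|time_measure T. \<phi> t *\<^sub>R G t)"
      unfolding scaleR_add_right by (intro Bochner_Integration.integral_add int cont L2)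
    ultimately show "(LINT t|time_measure T. deriv \<phi> t *\<^sub>R S (u t + v t))
        = - (LINT t|time_measure T. \<phi> t *\<^sub>R (F t + G t))"
      using assms \<phi> by (simp add: lifted_deriv_def)
  qed (intro L2_space_add L2)+
qed

lemma lifted_deriv_scaleR:
  assumes "lifted_deriv T v G"
  shows "lifted_deriv T (\<lambda>t. c *\<^sub>R v t) (\<lambda>t. c *\<^sub>R G t)"
  unfolding lifted_deriv_def
proof (intro conjI allI impI)
  fix \<phi> assume \<phi>: "test_function T \<phi>"
  have "(LINT t|time_measure T. deriv \<phi> t *\<^sub>R S (c *\<^sub>R v t)) = c *\<^sub>R (LINT t|time_measure T. deriv \<phi> t *\<^sub>R S (v t))"
    unfolding S.scaleR scaleR_left_commute[of _ c] by (rule integral_scaleR_right)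
  moreover have "(LINT t|time_measure T. \<phi> t *\<^sub>R (c *\<^sub>R G t)) = c *\<^sub>R (LINT t|time_measure T. \<phi> t *\<^sub>R G t)"
    unfolding scaleR_left_commute[of _ c] by (rule integral_scaleR_right)
  ultimately show "(LINT t|time_measure T. deriv \<phi> t *\<^sub>R S (c *\<^sub>R v t))
      = - (LINT t|time_measure T. \<phi> t *\<^sub>R (c *\<^sub>R G t))"
    using assms \<phi> by (simp add: lifted_deriv_def)
qed (use assms in \<open>auto simp: lifted_deriv_def intro: L2_space_bounded_linear[OF bounded_linear_scaleR_right]\<close>)

lemma W_space_add: "u \<in> W_space T \<iota> \<Longrightarrow> v \<in> W_space T \<iota> \<Longrightarrow> (\<lambda>t. u t + v t) \<in> W_space T \<iota>"
  and W_space_scaleR: "v \<in> W_space T \<iota> \<Longrightarrow> (\<lambda>t. c *\<^sub>R v t) \<in> W_space T \<iota>"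
  using lifted_deriv_add lifted_deriv_scaleR unfolding W_space_iff by blast+

lemma linear_form_on_lift_wd:
  assumes "T > 0" and F: "F \<in> L2_space T"
  shows "linear_form_on T (W_space T \<iota>) (\<lambda>v. LINT t|time_measure T. a (F t) (lift_wd T v t))"
  unfolding linear_form_on_def
proof (intro conjI ballI allI impI)
  let ?M = "time_measure T"
  \<comment> \<open>The chosen derivatives need not be additive or homogeneous pointwise. Under the
    integral they may be replaced by any lifted derivative, in particular by the sum or multiple of
    the chosen ones.\<close>
  have cong: "(LINT t|?M. a (F t) (lift_wd T u t)) = (LINT t|?M. a (F t) (G t))"
    if "u \<in> W_space T \<iota>" "lifted_deriv T v G" "AE t in ?M. u t = v t" for u v G
  proof (rule integral_cong_AE)
    show "AE t in ?M. a (F t) (lift_wd T u t) = a (F t) (G t)"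
      using lifted_deriv_unique[OF \<open>T > 0\<close> lifted_deriv_lift_wd that(2,3), OF that(1)]
      by eventually_elim simp
    have "G \<in> L2_space T" using that(2) by (simp add: lifted_deriv_def)
    then show "(\<lambda>t. a (F t) (G t)) \<in> borel_measurable ?M"
      by (intro borel_measurable_integrable integrable_form F)
  qed (intro borel_measurable_integrable integrable_form F lift_wd_L2 that)
  fix u v assume u: "u \<in> W_space T \<iota>" and v: "v \<in> W_space T \<iota>"
  show "(LINT t|?M. a (F t) (lift_wd T u t)) = (LINT t|?M. a (F t) (lift_wd T v t))" if "ae_eq T u v"
    by (rule cong[OF u lifted_deriv_lift_wd[OF v]]) (use that in \<open>simp add: ae_eq_def\<close>)
  have "(LINT t|?M. a (F t) (lift_wd T (\<lambda>t. u t + v t) t)) = (LINT t|?M. a (F t) (lift_wd T u t + lift_wd T v t))"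
    by (rule cong[OF W_space_add[OF u v] lifted_deriv_add[OF lifted_deriv_lift_wd[OF u] lifted_deriv_lift_wd[OF v]]]) simp
  also have "\<dots> = (LINT t|?M. a (F t) (lift_wd T u t)) + (LINT t|?M. a (F t) (lift_wd T v t))"
    unfolding form.add_right by (intro Bochner_Integration.integral_add integrable_form F lift_wd_L2 u v)
  finally show "(LINT t|?M. a (F t) (lift_wd T (\<lambda>t. u t + v t) t))
      = (LINT t|?M. a (F t) (lift_wd T u t)) + (LINT t|?M. a (F t) (lift_wd T v t))" .
  fix c :: real
  have "(LINT t|?M. a (F t) (lift_wd T (\<lambda>t. c *\<^sub>R u t) t)) = (LINT t|?M. a (F t) (c *\<^sub>R lift_wd T u t))"
    by (rule cong[OF W_space_scaleR[OF u] lifted_deriv_scaleR[OF lifted_deriv_lift_wd[OF u]]]) simp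
  then show "(LINT t|?M. a (F t) (lift_wd T (\<lambda>t. c *\<^sub>R u t) t)) = c * (LINT t|?M. a (F t) (lift_wd T u t))"
    by (simp add: form.scaleR_right)
qed

lemma linear_form_on_integral_form:
  assumes F: "F \<in> L2_space T"
  shows "linear_form_on T (W_space T \<iota>) (\<lambda>v. LINT t|time_measure T. a (F t) (v t))"
  unfolding linear_form_on_def
proof (intro conjI ballI allI impI)
  let ?M = "time_measure T"
  fix u v assume u: "u \<in> W_space T \<iota>" and v: "v \<in> W_space T \<iota>"
  show "(LINT t|?M. a (F t) (u t)) = (LINT t|?M. a (F t) (v t))" if "ae_eq T u v"
  proof (rule integral_cong_AE)
    show "AE t in ?M. a (F t) (u t) = a (F t) (v t)"
      using that unfolding ae_eq_def by eventually_elim simp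
  qed (intro borel_measurable_integrable integrable_form F W_space_L2 u v)+
  show "(LINT t|?M. a (F t) (u t + v t)) = (LINT t|?M. a (F t) (u t)) + (LINT t|?M. a (F t) (v t))"
    unfolding form.add_right by (intro Bochner_Integration.integral_add integrable_form F W_space_L2 u v)
  show "(LINT t|?M. a (F t) (c *\<^sub>R u t)) = c * (LINT t|?M. a (F t) (u t))" for c
    by (simp add: form.scaleR_right)
qed

section \<open>The norm of W(0,T) and the trace estimate\<close>

lemma W_inner_eq:
  "W_inner T a \<iota> u v = (LINT t|time_measure T. a (lift_wd T u t) (lift_wd T v t)) + (LINT t|time_measure T. a (u t) (v t))"
  by (simp add: W_inner_def dual_inner_def lift_wd_def)

lemma integral_form_nonneg: "0 \<le> (LINT t|time_measure T. a (F t) (F t))"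
  by (simp add: form_nonneg)

lemma W_inner_nonneg: "0 \<le> W_inner T a \<iota> v v"
  unfolding W_inner_eq by (intro add_nonneg_nonneg integral_form_nonneg)

lemma W_norm_nonneg: "0 \<le> W_norm T a \<iota> v" and W_norm_sq: "(W_norm T a \<iota> v)\<^sup>2 = W_inner T a \<iota> v v"
  by (simp_all add: W_norm_def W_inner_nonneg)

lemma W_space_continuous_representative:
  assumes "T > 0"
  shows "\<exists>C\<ge>0. \<forall>v\<in>W_space T \<iota>. \<exists>q. continuous_on UNIV q \<and> (AE t in time_measure T. q t = \<iota> (v t)) \<and>
    (\<forall>t. (norm (q t))\<^sup>2 \<le> C * W_inner T a \<iota> v v)"
proof -
  let ?M = "time_measure T"
  obtain A where A: "\<And>x y. \<bar>a x y\<bar> \<le> norm x * norm y * A" "A > 0"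
    using form.pos_bounded by auto
  obtain I where I: "\<And>x. norm (\<iota> x) \<le> norm x * I" "I > 0"
    using emb.pos_bounded by auto
  \<comment> \<open>The numerator bounds the two integrals from
    \<open>continuous_representative\<close> once each is at most \<open>w\<close>;
    \<open>1 / \<alpha>\<close> converts squared norms into energy, and \<open>1 / T\<close> stems
    from averaging in time.\<close>
  define C where "C = \<kappa>\<^sup>2 * (I\<^sup>2 + 4 * T * A) / (\<alpha> * T)"
  have "C \<ge> 0" using \<alpha>_pos \<open>T > 0\<close> A(2) by (simp add: C_def)
  moreover have "\<exists>q. continuous_on UNIV q \<and> (AE t in ?M. q t = \<iota> (v t)) \<and>
    (\<forall>t. (norm (q t))\<^sup>2 \<le> C * W_inner T a \<iota> v v)" if v: "v \<in> W_space T \<iota>" for v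
  proof -
    let ?G = "lift_wd T v"
    note vL2 = W_space_L2[OF v] and GL2 = lift_wd_L2[OF v]
    have "\<exists>c. AE t in ?M. S (v t) = c + prim T ?G t"
    proof (rule weak_derivative_imp_prim[OF _ _ \<open>T > 0\<close>])
      show "integrable ?M (\<lambda>t. S (v t))"
        by (intro L2_space_integrable L2_space_bounded_linear[OF S.bounded_linear_axioms] vL2)
    qed (use lifted_deriv_lift_wd[OF v] L2_space_integrable[OF GL2] in \<open>auto simp: lifted_deriv_def\<close>)
    then obtain c where "AE t in ?M. S (v t) = c + prim T ?G t" by blast
    from continuous_representative[OF vL2 GL2 \<open>T > 0\<close> this I(1) A(1)] A(2)
    obtain q where q: "continuous_on UNIV q" "AE t in ?M. q t = \<iota> (v t)"
      "\<And>t. T * (norm (q t))\<^sup>2 \<le> \<kappa>\<^sup>2 * (I\<^sup>2 * (LINT s|?M. (norm (v s))\<^sup>2)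
        + 4 * T * A * (LINT s|?M. norm (?G s) * norm (v s)))"
      by auto
    \<comment> \<open>Coercivity makes this a common bound: it dominates the sum of the squared L2
      norms of \<open>v\<close> and of its lifted derivative, hence also the integral of the product
      of their norms.\<close>
    define w where "w = W_inner T a \<iota> v v / \<alpha>"
    have sq: "(LINT s|?M. (norm (f s))\<^sup>2) \<le> (LINT s|?M. a (f s) (f s)) / \<alpha>" if "f \<in> L2_space T" for f
    proof -
      have "(LINT s|?M. (norm (f s))\<^sup>2) \<le> (LINT s|?M. a (f s) (f s) / \<alpha>)"
        by (intro integral_mono L2_space_integrable_sq that norm_sq_le_form)
          (use integrable_form[OF that that] in simp)
      then show ?thesis by simp
    qed
    have "(LINT s|?M. (norm (v s))\<^sup>2) + (LINT s|?M. (norm (?G s))\<^sup>2) \<le> w"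
      using sq[OF vL2] sq[OF GL2] by (simp add: w_def W_inner_eq add_divide_distrib)
    moreover have "(LINT s|?M. (norm (?G s))\<^sup>2) \<ge> 0" by simp
    moreover have "(LINT s|?M. norm (?G s) * norm (v s)) \<le> (LINT s|?M. (norm (?G s))\<^sup>2 + (norm (v s))\<^sup>2)"
    proof (rule integral_mono[OF L2_space_integrable_norm_mult[OF GL2 vL2]])
      show "integrable ?M (\<lambda>s. (norm (?G s))\<^sup>2 + (norm (v s))\<^sup>2)"
        by (intro Bochner_Integration.integrable_add L2_space_integrable_sq GL2 vL2)
      have "x * y \<le> x\<^sup>2 + y\<^sup>2" if "0 \<le> x" "0 \<le> y" for x y :: real
        using sum_squares_bound[of x y] mult_nonneg_nonneg[OF that] by simp
      then show "norm (?G s) * norm (v s) \<le> (norm (?G s))\<^sup>2 + (norm (v s))\<^sup>2" for s by simp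
    qed
    moreover have "(LINT s|?M. (norm (?G s))\<^sup>2 + (norm (v s))\<^sup>2)
        = (LINT s|?M. (norm (?G s))\<^sup>2) + (LINT s|?M. (norm (v s))\<^sup>2)"
      by (intro Bochner_Integration.integral_add L2_space_integrable_sq GL2 vL2)
    ultimately have le: "(LINT s|?M. (norm (v s))\<^sup>2) \<le> w" "(LINT s|?M. norm (?G s) * norm (v s)) \<le> w"
      by linarith+
    have "(norm (q t))\<^sup>2 \<le> C * W_inner T a \<iota> v v" for t
    proof -
      note q(3)[of t]
      also have "\<kappa>\<^sup>2 * (I\<^sup>2 * (LINT s|?M. (norm (v s))\<^sup>2) + 4 * T * A * (LINT s|?M. norm (?G s) * norm (v s)))
          \<le> \<kappa>\<^sup>2 * (I\<^sup>2 * w + 4 * T * A * w)"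
        using \<open>T > 0\<close> A(2) by (intro mult_left_mono add_mono le) auto
      also have "\<dots> = T * (C * W_inner T a \<iota> v v)"
        using \<open>T > 0\<close> \<alpha>_pos by (simp add: C_def w_def field_simps)
      finally show ?thesis using \<open>T > 0\<close> by simp
    qed
    with q(1,2) show ?thesis by blast
  qed
  ultimately show ?thesis by blast
qed

lemma point_value_bound:
  assumes "T > 0"
  shows "\<exists>C\<ge>0. \<forall>v\<in>W_space T \<iota>. \<forall>t\<in>{0..T}.
    (norm (point_value T \<iota> v t))\<^sup>2 \<le> C * W_inner T a \<iota> v v"
proof -
  obtain C where C: "C \<ge> 0" "\<And>v. v \<in> W_space T \<iota> \<Longrightarrow> \<exists>q. continuous_on UNIV q \<and>
      (AE t in time_measure T. q t = \<iota> (v t)) \<and> (\<forall>t. (norm (q t))\<^sup>2 \<le> C * W_inner T a \<iota> v v)"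
    using W_space_continuous_representative[OF assms] by metis
  have "(norm (point_value T \<iota> v t))\<^sup>2 \<le> C * W_inner T a \<iota> v v"
    if v: "v \<in> W_space T \<iota>" and t: "t \<in> {0..T}" for v t
  proof -
    obtain q where q: "continuous_on UNIV q" "AE t in time_measure T. q t = \<iota> (v t)"
      "\<And>t. (norm (q t))\<^sup>2 \<le> C * W_inner T a \<iota> v v" using C(2)[OF v] by blast
    have "point_value T \<iota> v t = q t"
      by (rule point_value_eq[where \<iota> = \<iota>]) (use q assms t continuous_on_subset[OF q(1) subset_UNIV] in auto)
    then show ?thesis using q(3) by simp
  qed
  with C(1) show ?thesis by blast
qed

text \<open>Sums and multiples of continuous representatives are continuous representatives of the
  sums and multiples, and a representative serves every function that is equal almost
  everywhere.\<close>

lemma linear_form_on_point_value: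
  assumes "T > 0" "t \<in> {0..T}"
  shows "linear_form_on T (W_space T \<iota>) (\<lambda>v. h \<bullet> point_value T \<iota> v t)"
  unfolding linear_form_on_def
proof (intro conjI ballI allI impI)
  have rep: "\<exists>q. continuous_on {0..T} q \<and> (AE s in time_measure T. q s = \<iota> (v s))" if "v \<in> W_space T \<iota>" for v
  proof -
    obtain C where "\<forall>v\<in>W_space T \<iota>. \<exists>q. continuous_on UNIV q \<and> (AE s in time_measure T. q s = \<iota> (v s)) \<and>
        (\<forall>t. (norm (q t))\<^sup>2 \<le> C * W_inner T a \<iota> v v)"
      using W_space_continuous_representative[OF \<open>T > 0\<close>] by blast
    from bspec[OF this that] show ?thesis using continuous_on_subset[OF _ subset_UNIV] by blast
  qed
  fix u v assume "u \<in> W_space T \<iota>" "v \<in> W_space T \<iota>"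
  then obtain p q where p: "continuous_on {0..T} p" "AE s in time_measure T. p s = \<iota> (u s)"
    and q: "continuous_on {0..T} q" "AE s in time_measure T. q s = \<iota> (v s)"
    using rep by meson
  note pu = point_value_eq[where \<iota> = \<iota>, OF p assms] and qv = point_value_eq[where \<iota> = \<iota>, OF q assms]
  show "h \<bullet> point_value T \<iota> u t = h \<bullet> point_value T \<iota> v t" if "ae_eq T u v"
  proof -
    have "AE s in time_measure T. q s = \<iota> (u s)"
      using q(2) that unfolding ae_eq_def by eventually_elim simp
    from point_value_eq[where \<iota> = \<iota>, OF q(1) this assms] qv show ?thesis by simp
  qed
  have "AE s in time_measure T. p s + q s = \<iota> (u s + v s)"
    using p(2) q(2) by eventually_elim (simp add: emb.add)
  from point_value_eq[where \<iota> = \<iota>, OF continuous_on_add[OF p(1) q(1)] this assms]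
  show "h \<bullet> point_value T \<iota> (\<lambda>t. u t + v t) t = h \<bullet> point_value T \<iota> u t + h \<bullet> point_value T \<iota> v t"
    by (simp add: pu qv inner_add_right)
  fix c :: real
  have "AE s in time_measure T. c *\<^sub>R p s = \<iota> (c *\<^sub>R u s)"
    using p(2) by eventually_elim (simp add: emb.scaleR)
  from point_value_eq[where \<iota> = \<iota>, OF continuous_on_scaleR[OF continuous_on_const p(1)] this assms]
  show "h \<bullet> point_value T \<iota> (\<lambda>t. c *\<^sub>R u t) t = c * (h \<bullet> point_value T \<iota> u t)"
    by (simp add: pu)
qed

section \<open>The forms \<open>b_form\<close> and \<open>l_form\<close>\<close>

lemma b_form_eq: "b_form T a \<iota> v w = W_inner T a \<iota> v w + point_value T \<iota> v T \<bullet> point_value T \<iota> w T"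
  by (simp add: b_form_def W_inner_def)

lemma b_form_commute: "b_form T a \<iota> v w = b_form T a \<iota> w v"
proof -
  have "(\<lambda>t. a (lift_wd T v t) (lift_wd T w t)) = (\<lambda>t. a (lift_wd T w t) (lift_wd T v t))"
    "(\<lambda>t. a (v t) (w t)) = (\<lambda>t. a (w t) (v t))" by (rule ext, rule sym)+
  then show ?thesis by (simp add: b_form_eq W_inner_eq inner_commute)
qed

lemma bilinear_form_on_b_form:
  assumes "T > 0"
  shows "bilinear_form_on T (W_space T \<iota>) (b_form T a \<iota>)"
proof -
  have right: "linear_form_on T (W_space T \<iota>) (b_form T a \<iota> v)" if v: "v \<in> W_space T \<iota>" for v
    unfolding b_form_eq[abs_def] W_inner_eq
    by (intro linear_form_on_add linear_form_on_lift_wd linear_form_on_integral_form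
        linear_form_on_point_value lift_wd_L2 W_space_L2 v assms) (use assms in simp)
  have "(\<lambda>v. b_form T a \<iota> v w) = b_form T a \<iota> w" for w
    by (rule ext) (rule b_form_commute)
  with right show ?thesis by (simp add: bilinear_form_on_def)
qed

lemma symmetric_on_b_form: "symmetric_on W (b_form T a \<iota>)"
  unfolding symmetric_on_def by (intro ballI b_form_commute)

lemma W_inner_le_b_form: "W_inner T a \<iota> v v \<le> b_form T a \<iota> v v"
  by (simp add: b_form_eq)

lemma coercive_on_b_form: "coercive_on W (W_norm T a \<iota>) (b_form T a \<iota>)"
  unfolding coercive_on_def
  by (intro exI[of _ 1]) (simp add: W_norm_sq W_inner_le_b_form)

text \<open>The form is symmetric and non-negative, so its own Cauchy-Schwarz inequality reduces the
  claim to the diagonal, where the trace estimate at \<open>T\<close> gives the factor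
  \<open>1 + C\<close>.\<close>

lemma bounded_form_on_b_form:
  assumes "T > 0"
  shows "bounded_form_on (W_space T \<iota>) (W_norm T a \<iota>) (b_form T a \<iota>)"
proof -
  obtain C where C: "C \<ge> 0" "\<And>v t. v \<in> W_space T \<iota> \<Longrightarrow> t \<in> {0..T} \<Longrightarrow>
    (norm (point_value T \<iota> v t))\<^sup>2 \<le> C * W_inner T a \<iota> v v" using point_value_bound[OF assms] by blast
  have diag: "b_form T a \<iota> v v \<le> (1 + C) * (W_norm T a \<iota> v)\<^sup>2" if "v \<in> W_space T \<iota>" for v
    using C(2)[OF that, of T] assms by (simp add: b_form_eq W_norm_sq power2_norm_eq_inner distrib_right)
  have nonneg: "0 \<le> b_form T a \<iota> v v" for v
    using W_inner_nonneg W_inner_le_b_form by (rule order_trans)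
  have "\<bar>b_form T a \<iota> u v\<bar> \<le> (1 + C) * W_norm T a \<iota> u * W_norm T a \<iota> v"
    if u: "u \<in> W_space T \<iota>" and v: "v \<in> W_space T \<iota>" for u v
  proof (rule power2_le_imp_le)
    have "(b_form T a \<iota> u v)\<^sup>2 \<le> b_form T a \<iota> u u * b_form T a \<iota> v v"
      by (rule symmetric_form_Cauchy_Schwarz[OF bilinear_form_on_b_form[OF assms] symmetric_on_b_form
            nonneg W_space_add W_space_scaleR u v])
    also have "\<dots> \<le> ((1 + C) * (W_norm T a \<iota> u)\<^sup>2) * ((1 + C) * (W_norm T a \<iota> v)\<^sup>2)"
      using C(1) by (intro mult_mono diag u v nonneg) auto
    finally show "\<bar>b_form T a \<iota> u v\<bar>\<^sup>2 \<le> ((1 + C) * W_norm T a \<iota> u * W_norm T a \<iota> v)\<^sup>2"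
      by (simp add: power2_eq_square ac_simps)
  qed (use C(1) W_norm_nonneg in simp)
  then show ?thesis unfolding bounded_form_on_def by blast
qed

text \<open>Expressing the duality pairing through the Riesz lift gives both integrals the same
  shape, so that one Cauchy-Schwarz inequality covers them.\<close>

lemma l_form_eq: "l_form T a \<iota> f y0 w = y0 \<bullet> point_value T \<iota> w 0 +
    (LINT t|time_measure T. a (riesz_lift a (f t)) (lift_wd T w t)) +
    (LINT t|time_measure T. a (riesz_lift a (f t)) (w t))"
  by (simp add: l_form_def dual_inner_def lift_wd_def del: form_riesz_lift) simp

lemma linear_form_on_l_form:
  assumes "T > 0" "f \<in> L2_space T"
  shows "linear_form_on T (W_space T \<iota>) (l_form T a \<iota> f y0)"
  unfolding l_form_eq[abs_def]
  by (intro linear_form_on_add linear_form_on_lift_wd linear_form_on_integral_form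
      linear_form_on_point_value) (use assms in \<open>auto simp: L2_space_riesz_lift_iff\<close>)

lemma continuous_form_on_l_form:
  assumes "T > 0" and f: "f \<in> L2_space T"
  shows "continuous_form_on (W_space T \<iota>) (W_norm T a \<iota>) (l_form T a \<iota> f y0)"
proof -
  let ?l = "l_form T a \<iota> f y0" and ?F = "\<lambda>t. riesz_lift a (f t)" and ?W = "W_space T \<iota>"
  have F: "?F \<in> L2_space T" using f by (simp add: L2_space_riesz_lift_iff)
  obtain C where C: "C \<ge> 0" "\<And>v t. v \<in> ?W \<Longrightarrow> t \<in> {0..T} \<Longrightarrow>
    (norm (point_value T \<iota> v t))\<^sup>2 \<le> C * W_inner T a \<iota> v v" using point_value_bound[OF assms(1)] by blast
  define N where "N = sqrt (LINT t|time_measure T. a (?F t) (?F t))"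
  \<comment> \<open>The first summand is the initial datum times the trace constant at time 0; each
    of the two integrals contributes one \<open>N\<close>, the energy norm of the lifted
    \<open>f\<close>.\<close>
  define M where "M = norm y0 * sqrt C + N + N"
  have N: "N \<ge> 0" unfolding N_def by (intro real_sqrt_ge_zero integral_form_nonneg)
  have M: "M \<ge> 0" using N C(1) by (simp add: M_def)
  have bound: "\<bar>?l w\<bar> \<le> M * W_norm T a \<iota> w" if w: "w \<in> ?W" for w
  proof -
    have "norm (point_value T \<iota> w 0) \<le> sqrt (C * W_inner T a \<iota> w w)"
      by (rule real_le_rsqrt, rule C(2)[OF w]) (use assms in simp)
    then have "norm y0 * norm (point_value T \<iota> w 0) \<le> norm y0 * (sqrt C * W_norm T a \<iota> w)"
      by (intro mult_left_mono) (simp_all add: real_sqrt_mult W_norm_def)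
    with Cauchy_Schwarz_ineq2[of y0 "point_value T \<iota> w 0"]
    have 1: "\<bar>y0 \<bullet> point_value T \<iota> w 0\<bar> \<le> norm y0 * sqrt C * W_norm T a \<iota> w" by simp
    have "sqrt (LINT t|time_measure T. a (lift_wd T w t) (lift_wd T w t)) \<le> W_norm T a \<iota> w"
      "sqrt (LINT t|time_measure T. a (w t) (w t)) \<le> W_norm T a \<iota> w"
      unfolding W_norm_def W_inner_eq by (simp_all add: form_nonneg)
    from mult_left_mono[OF this(1) N] mult_left_mono[OF this(2) N]
    have "\<bar>LINT t|time_measure T. a (?F t) (lift_wd T w t)\<bar> \<le> N * W_norm T a \<iota> w"
      "\<bar>LINT t|time_measure T. a (?F t) (w t)\<bar> \<le> N * W_norm T a \<iota> w"
      using integral_form_Cauchy_Schwarz[OF F lift_wd_L2[OF w]] integral_form_Cauchy_Schwarz[OF F W_space_L2[OF w]]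
      unfolding N_def by linarith+
    with 1 show ?thesis unfolding l_form_eq M_def distrib_right by linarith
  qed
  show ?thesis
    unfolding continuous_form_on_def
  proof (intro ballI allI impI)
    fix u and \<epsilon> :: real assume u: "u \<in> ?W" and "\<epsilon> > 0"
    show "\<exists>\<delta>>0. \<forall>v\<in>?W. W_norm T a \<iota> (\<lambda>t. v t - u t) < \<delta> \<longrightarrow> \<bar>?l v - ?l u\<bar> < \<epsilon>"
    \<comment> \<open>\<open>M + 1\<close> instead of \<open>M\<close>, since \<open>M\<close> may
      be 0.\<close>
    proof (intro exI[of _ "\<epsilon> / (M + 1)"] conjI ballI impI)
      show "\<epsilon> / (M + 1) > 0" using \<open>\<epsilon> > 0\<close> M by simp
      fix v assume v: "v \<in> ?W" and less: "W_norm T a \<iota> (\<lambda>t. v t - u t) < \<epsilon> / (M + 1)"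
      have lin: "linear_form_on T ?W ?l" by (rule linear_form_on_l_form[OF assms])
      \<comment> \<open>Linearity is available for sums and multiples only, so the difference is
        treated as \<open>v\<close> plus \<open>- 1\<close> times \<open>u\<close>.\<close>
      have mu: "(\<lambda>t. (- 1) *\<^sub>R u t) \<in> ?W" by (rule W_space_scaleR[OF u])
      have add: "?l (\<lambda>t. x t + y t) = ?l x + ?l y" and scale: "?l (\<lambda>t. c *\<^sub>R x t) = c * ?l x"
        if "x \<in> ?W" "y \<in> ?W" for x y c
        using lin that unfolding linear_form_on_def by blast+
      from add[OF v mu] scale[OF u u, of "- 1"]
      have diff: "?l (\<lambda>t. v t - u t) = ?l v - ?l u" by simp
      have "(\<lambda>t. v t - u t) \<in> ?W" using W_space_add[OF v mu] by simp
      from bound[OF this] have "\<bar>?l v - ?l u\<bar> \<le> M * W_norm T a \<iota> (\<lambda>t. v t - u t)" by (simp add: diff)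
      also have "\<dots> \<le> (M + 1) * W_norm T a \<iota> (\<lambda>t. v t - u t)"
        by (intro mult_right_mono W_norm_nonneg) simp
      also have "\<dots> < \<epsilon>" using less M by (simp add: field_simps)
      finally show "\<bar>?l v - ?l u\<bar> < \<epsilon>" .
    qed
  qed
qed

end

theorem theorem2p4:
  fixes \<iota> :: "'v::{real_inner, banach, second_countable_topology}
               \<Rightarrow> 'h::{real_inner, banach, second_countable_topology}"
    and a :: "'v \<Rightarrow> 'v \<Rightarrow> real"
    and T :: real
    and f :: "real \<Rightarrow> ('v \<Rightarrow>\<^sub>L real)"
    and y0 :: 'h
  assumes "gelfand_triple \<iota>"
    and "bounded_bilinear a"
    and "symmetric_on UNIV a"
    and "coercive_on UNIV norm a"
    and "T > 0"
    and "f \<in> L2_space T"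
  shows "bilinear_form_on T (W_space T \<iota>) (b_form T a \<iota>)
       \<and> symmetric_on (W_space T \<iota>) (b_form T a \<iota>)
       \<and> bounded_form_on (W_space T \<iota>) (W_norm T a \<iota>) (b_form T a \<iota>)
       \<and> coercive_on (W_space T \<iota>) (W_norm T a \<iota>) (b_form T a \<iota>)
       \<and> linear_form_on T (W_space T \<iota>) (l_form T a \<iota> f y0)
       \<and> continuous_form_on (W_space T \<iota>) (W_norm T a \<iota>) (l_form T a \<iota> f y0)"
proof -
  have "coercive_form a"
    using assms(2-4) by (intro coercive_form.intro) (auto simp: symmetric_on_def)
  then interpret gelfand_form a \<iota>
    using assms(1) by (intro gelfand_form.intro gelfand_form_axioms.intro)
  show ?thesis
    using assms(5,6)
    by (intro conjI bilinear_form_on_b_form symmetric_on_b_form bounded_form_on_b_form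
        coercive_on_b_form linear_form_on_l_form continuous_form_on_l_form)
qed

end
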